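(* For every $w\in S_\infty$, $$\mathfrak{S}_w(1)\ \geq\ 1+p_{132}(w)+p_{1432}(w).$$
   Context: $S_\infty$ is the group of permutations of $\mathbb{Z}_{>0}$ that fix all but finitely many elements; $S_n$ is regarded as the subgroup of those $w$ with $w(m)=m$ for all $m>n$. Permutations are written in one-line notation, e.g. $1432$ is the permutation $u\in S_4$ with $u(1)=1,u(2)=4,u(3)=3,u(4)=2$. Schubert polynomials: $\mathfrak{S}_w\in\mathbb{Z}[x_1,x_2,\ldots]$ is the (ordinary) Schubert polynomial of $w\in S_\infty$, characterized by $\mathfrak{S}_{w_0}=x_1^{n-1}x_2^{n-2}\cdots x_{n-1}$ for $w_0=n,n-1,\ldots,1\in S_n$, and $\mathfrak{S}_{ws_i}=\partial_i\mathfrak{S}_w$ whenever $w(i)>w(i+1)$. Here $s_i$ is the simple transposition exchanging $i$ and $i+1$, products are composed as functions from right to left, and $\partial_i f=\frac{f-s_if}{x_i-x_{i+1}}$, where $s_i f$ exchanges the variables $x_i$ and $x_{i+1}$ in $f$. These polynomials are compatible with the inclusions $S_n\subset S_{n+1}$. The principal specialization is $\mathfrak{S}_w(1):=\mathfrak{S}_w(1,1,1,\ldots)$, i.e. all variables set to $1$. Pattern occurrences: for $u\in S_k$ with $u(k)\neq k$ and $w\in S_\infty$, $p_u(w)$ is the number of $k$-tuples of positive integers $a_1<a_2<\cdots<a_k$ such that for all $1\leq i<j\leq k$, $w(a_i)<w(a_j)$ if and only if $u(i)<u(j)$. (This number is finite.) *)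

theory Defs
  imports "HOL-Library.Poly_Mapping" "HOL-Combinatorics.Permutations"
begin

section \<open>Polynomials in countably many variables\<close>

text \<open>
  Monomials are exponent vectors, and a polynomial maps monomials to coefficients. The variable
  with index 0 is not used: the polynomials of interest only involve \<open>X i\<close> with \<open>i \<ge> 1\<close>.
\<close>

type_synonym intpoly = "(nat \<Rightarrow>\<^sub>0 nat) \<Rightarrow>\<^sub>0 int"

definition X :: "nat \<Rightarrow> intpoly" where
  "X i = Poly_Mapping.single (Poly_Mapping.single i 1) 1"

definition eval_poly :: "(nat \<Rightarrow> int) \<Rightarrow> intpoly \<Rightarrow> int" where
  "eval_poly a f =
     (\<Sum>m\<in>Poly_Mapping.keys f. Poly_Mapping.lookup f m *
        (\<Prod>i\<in>Poly_Mapping.keys m. a i ^ Poly_Mapping.lookup m i))"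

text \<open>
  The coefficient of \<open>m\<close> in \<open>swap_vars i f\<close> is the coefficient in \<open>f\<close> of the monomial obtained
  from \<open>m\<close> by exchanging the exponents of \<open>X i\<close> and \<open>X (Suc i)\<close>.
\<close>

definition swap_vars :: "nat \<Rightarrow> intpoly \<Rightarrow> intpoly" where
  "swap_vars i f = Poly_Mapping.map_key (Poly_Mapping.map_key (transpose i (Suc i))) f"

text \<open>The quotient exists and is unique, see \<open>divided_difference_mult\<close> below.\<close>

definition divided_difference :: "nat \<Rightarrow> intpoly \<Rightarrow> intpoly" where
  "divided_difference i f = (THE g. (X i - X (Suc i)) * g = f - swap_vars i f)"


section \<open>Schubert polynomials\<close>

definition S_infinity :: "(nat \<Rightarrow> nat) set" where
  "S_infinity = {w. w permutes {1..} \<and> finite {m. w m \<noteq> m}}"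

definition longest_perm :: "nat \<Rightarrow> nat \<Rightarrow> nat" where
  "longest_perm n i = (if i \<in> {1..n} then n + 1 - i else i)"

definition is_schubert_family :: "((nat \<Rightarrow> nat) \<Rightarrow> intpoly) \<Rightarrow> bool" where
  "is_schubert_family F \<longleftrightarrow>
     (\<forall>n\<ge>1. F (longest_perm n) = (\<Prod>i=1..n. X i ^ (n - i))) \<and>
     (\<forall>w\<in>S_infinity. \<forall>i\<ge>1. w i > w (Suc i) \<longrightarrow>
        F (w \<circ> transpose i (Suc i)) = divided_difference i (F w))"

text \<open>
  The two conditions determine a family on \<open>S_infinity\<close> and are satisfiable, see
  \<open>is_schubert_family_schubert\<close> and \<open>schubert_unique\<close> below; values outside \<open>S_infinity\<close>
  are irrelevant.
\<close>

definition schubert :: "(nat \<Rightarrow> nat) \<Rightarrow> intpoly" where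
  "schubert = (SOME F. is_schubert_family F)"

definition principal_specialization :: "(nat \<Rightarrow> nat) \<Rightarrow> int" where
  "principal_specialization w = eval_poly (\<lambda>_. 1) (schubert w)"


section \<open>Pattern occurrences\<close>

text \<open>
  The pattern \<open>u\<close> is given in one-line notation; since lists are indexed from 0, its \<open>i\<close>-th
  entry is \<open>u ! (i - 1)\<close>, and likewise for the tuple \<open>a\<close> of positions.
\<close>

definition pattern_occurrences :: "nat list \<Rightarrow> (nat \<Rightarrow> nat) \<Rightarrow> nat list set" where
  "pattern_occurrences u w =
     {a. length a = length u \<and> set a \<subseteq> {1..} \<and> sorted_wrt (<) a \<and>
         (\<forall>i j. i < j \<and> j < length u \<longrightarrow> (w (a ! i) < w (a ! j) \<longleftrightarrow> u ! i < u ! j))}"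

text \<open>
  Cardinality is meaningful here because the set is finite when the last entry of the pattern
  is not its largest one, see \<open>finite_pattern_occurrences\<close> below.
\<close>

definition pattern_count :: "nat list \<Rightarrow> (nat \<Rightarrow> nat) \<Rightarrow> nat" where
  "pattern_count u w = card (pattern_occurrences u w)"


section \<open>Well-definedness\<close>

lemma finite_pattern_occurrences:
  assumes w: "w \<in> S_infinity" and u: "j < length u" "u ! j > last u"
  shows "finite (pattern_occurrences u w)"
proof -
  have fin: "finite {m. w m \<noteq> m}" and perm: "w permutes {1..}"
    using w by (auto simp: S_infinity_def)
  obtain N where N: "\<And>m. w m \<noteq> m \<Longrightarrow> m \<le> N"
    using fin by (auto simp: finite_nat_set_iff_bounded_le)
  have small: "w m < b" if "m < b" "N < b" for m b
  proof (rule ccontr)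
    assume "\<not> w m < b"
    then have "w (w m) = w m" using N[of "w m"] that by force
    then have "w m = m" using perm by (metis permutes_inj injD)
    then show False using that \<open>\<not> w m < b\<close> by simp
  qed
  have "pattern_occurrences u w \<subseteq> {a. set a \<subseteq> {..N} \<and> length a = length u}"
  proof
    fix a assume a: "a \<in> pattern_occurrences u w"
    let ?k = "length u - 1"
    have len: "length a = length u" and so: "sorted_wrt (<) a"
      and iff: "\<And>i j. i < j \<Longrightarrow> j < length u \<Longrightarrow> (w (a ! i) < w (a ! j) \<longleftrightarrow> u ! i < u ! j)"
      using a by (auto simp: pattern_occurrences_def)
    have lu: "last u = u ! ?k" using u by (intro last_conv_nth) auto
    have "j \<noteq> ?k" using u lu by auto
    then have jk: "j < ?k" using u by linarith
    have "\<not> w (a ! j) < w (a ! ?k)" using iff[OF jk] u lu jk by simp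
    moreover have "a ! j < a ! ?k" using so jk len by (simp add: sorted_wrt_iff_nth_less)
    ultimately have kN: "a ! ?k \<le> N"
      using small[of "a ! j" "a ! ?k"] N[of "a ! ?k"] by force
    have "x \<le> N" if "x \<in> set a" for x
    proof -
      obtain i where i: "i < length a" "x = a ! i" using \<open>x \<in> set a\<close> by (auto simp: in_set_conv_nth)
      show ?thesis
      proof (cases "i = ?k")
        case True
        then show ?thesis using kN i by simp
      next
        case False
        then have "i < ?k" "?k < length a" using i len by linarith+
        then have "a ! i < a ! ?k" using so by (simp only: sorted_wrt_iff_nth_less)
        then show ?thesis using kN i by linarith
      qed
    qed
    then show "a \<in> {a. set a \<subseteq> {..N} \<and> length a = length u}" using len by auto
  qed
  then show ?thesis by (rule finite_subset) (simp add: finite_lists_length_eq)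
qed

lemma intpoly_induct [case_names single add]:
  fixes f :: intpoly
  assumes "\<And>m c. P (Poly_Mapping.single m c)" and "\<And>f g. P f \<Longrightarrow> P g \<Longrightarrow> P (f + g)"
  shows "P f"
proof (induction f rule: Poly_Mapping.update_induct)
  case const
  show ?case using assms(1)[of 0 0] by simp
next
  case (update f a b)
  have "Poly_Mapping.update a b f = f + Poly_Mapping.single a b"
    using update by (intro poly_mapping_eqI)
      (auto simp: lookup_update lookup_add lookup_single in_keys_iff when_def)
  then show ?case using assms update by metis
qed

context
  fixes i :: nat
begin

lemma inj_map_key_transpose:
  "inj (Poly_Mapping.map_key (transpose i (Suc i)) :: (nat \<Rightarrow>\<^sub>0 nat) \<Rightarrow> _)"
  by (rule inj_on_inverseI[where g = "Poly_Mapping.map_key (transpose i (Suc i))"])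
     (simp add: map_key_compose o_def map_key_id)

lemma swap_vars_add: "swap_vars i (f + g) = swap_vars i f + swap_vars i g"
  unfolding swap_vars_def by (simp add: map_key_plus inj_map_key_transpose)

lemma swap_vars_swap_vars [simp]: "swap_vars i (swap_vars i f) = f"
  unfolding swap_vars_def
  by (simp add: map_key_compose inj_map_key_transpose o_def map_key_id)

lemma swap_vars_single:
  "swap_vars i (Poly_Mapping.single m c) = Poly_Mapping.single (Poly_Mapping.map_key (transpose i (Suc i)) m) c"
proof -
  have "m = Poly_Mapping.map_key (transpose i (Suc i)) (Poly_Mapping.map_key (transpose i (Suc i)) m)"
    by (simp add: map_key_compose o_def map_key_id)
  then show ?thesis
    unfolding swap_vars_def by (metis map_key_single inj_map_key_transpose)
qed

lemma swap_vars_diff: "swap_vars i (f - g) = swap_vars i f - swap_vars i g"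
  by (metis add_diff_cancel diff_add_cancel swap_vars_add)

lemma swap_vars_mult: "swap_vars i (f * g) = swap_vars i f * swap_vars i g"
proof (induction f rule: intpoly_induct)
  case (single m c)
  show ?case
    by (induction g rule: intpoly_induct)
       (simp_all add: swap_vars_single mult_single map_key_plus distrib_left swap_vars_add)
next
  case (add f g)
  then show ?case by (simp add: swap_vars_add distrib_right)
qed

lemma swap_vars_X: "swap_vars i (X k) = X (transpose i (Suc i) k)"
proof -
  have "Poly_Mapping.map_key (transpose i (Suc i)) (Poly_Mapping.single (transpose i (Suc i) (transpose i (Suc i) k)) (1::nat)) = Poly_Mapping.single (transpose i (Suc i) k) 1"
    by (subst map_key_single) simp_all
  then show ?thesis by (simp add: X_def swap_vars_single)
qed

lemma swap_vars_1 [simp]: "swap_vars i 1 = 1"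
  using swap_vars_single[of 0 1] by simp

lemma swap_vars_power: "swap_vars i (f ^ n) = swap_vars i f ^ n"
  by (induction n) (simp_all add: swap_vars_mult)

lemma swap_vars_prod: "swap_vars i (\<Prod>k\<in>A. f k) = (\<Prod>k\<in>A. swap_vars i (f k))"
  by (induction A rule: infinite_finite_induct) (simp_all add: swap_vars_mult)

end

lemma X_eq_iff [simp]: "X i = X j \<longleftrightarrow> i = j"
  unfolding X_def by (metis lookup_single_eq lookup_single_not_eq zero_neq_one)

lemma X_diff_dvd: "X i - X (Suc i) dvd f - swap_vars i f"
proof (induction f rule: intpoly_induct)
  case (single m c)
  let ?d = "X i - X (Suc i)"
  have mult: "?d dvd f * g - swap_vars i (f * g)"
    if "?d dvd f - swap_vars i f" "?d dvd g - swap_vars i g" for f g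
  proof -
    have "f * g - swap_vars i (f * g) = (f - swap_vars i f) * g + swap_vars i f * (g - swap_vars i g)"
      by (simp add: swap_vars_mult algebra_simps)
    then show ?thesis using that by simp
  qed
  have var: "?d dvd X k - swap_vars i (X k)" for k
  proof -
    have "?d dvd X (Suc i) - X i" by (metis dvd_minus_iff dvd_refl minus_diff_eq)
    then show ?thesis by (simp add: swap_vars_X transpose_def)
  qed
  have pow: "?d dvd X k ^ n - swap_vars i (X k ^ n)" for k n
    by (induction n) (simp_all add: mult[OF var])
  have X_pow: "X k ^ n = Poly_Mapping.single (Poly_Mapping.single k n) 1" for k n
  proof (induction n)
    case (Suc n)
    have "X k ^ Suc n = X k * Poly_Mapping.single (Poly_Mapping.single k n) 1" using Suc by simp
    also have "\<dots> = Poly_Mapping.single (Poly_Mapping.single k (1 + n)) 1"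
      unfolding X_def mult_single single_add by simp
    finally show ?case by simp
  qed simp
  show ?case
  proof (induction m rule: Poly_Mapping.update_induct)
    case const
    show ?case by (simp add: swap_vars_single)
  next
    case (update m k n)
    have "Poly_Mapping.update k n m = m + Poly_Mapping.single k n"
      using update by (intro poly_mapping_eqI)
        (auto simp: lookup_update lookup_add lookup_single in_keys_iff when_def)
    then have "Poly_Mapping.single (Poly_Mapping.update k n m) c = Poly_Mapping.single m c * X k ^ n"
      by (simp add: X_pow mult_single)
    then show ?case using mult[OF update.IH pow] by simp
  qed
next
  case (add f g)
  have "f + g - swap_vars i (f + g) = (f - swap_vars i f) + (g - swap_vars i g)"
    by (simp add: swap_vars_add)
  then show ?case using dvd_add[OF add] by (simp only:)
qed

lemma divided_difference_mult:
  "(X i - X (Suc i)) * divided_difference i f = f - swap_vars i f"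
proof -
  have "\<exists>!g. (X i - X (Suc i)) * g = f - swap_vars i f"
  proof (rule ex_ex1I)
    show "\<exists>g. (X i - X (Suc i)) * g = f - swap_vars i f"
      using X_diff_dvd[of i f] by (metis dvdE)
  next
    fix g h assume "(X i - X (Suc i)) * g = f - swap_vars i f" "(X i - X (Suc i)) * h = f - swap_vars i f"
    then have "(X i - X (Suc i)) * g = (X i - X (Suc i)) * h" by simp
    then show "g = h" by simp
  qed
  from theI'[OF this] show ?thesis unfolding divided_difference_def .
qed

lemma divided_difference_eqI:
  "(X i - X (Suc i)) * g = f - swap_vars i f \<Longrightarrow> divided_difference i f = g"
  by (simp flip: divided_difference_mult)

lemma swap_vars_compose:
  "swap_vars i (swap_vars j f) =
     Poly_Mapping.map_key (Poly_Mapping.map_key (transpose i (Suc i) \<circ> transpose j (Suc j))) f"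
proof -
  have "Poly_Mapping.map_key (transpose j (Suc j)) \<circ> Poly_Mapping.map_key (transpose i (Suc i)) =
      (Poly_Mapping.map_key (transpose i (Suc i) \<circ> transpose j (Suc j)) :: (nat \<Rightarrow>\<^sub>0 nat) \<Rightarrow> _)"
    by (rule ext) (simp add: map_key_compose)
  then show ?thesis
    unfolding swap_vars_def by (simp add: map_key_compose inj_map_key_transpose)
qed

lemma transpose_far:
  "Suc i < j \<Longrightarrow> transpose i (Suc i) \<circ> transpose j (Suc j) = transpose j (Suc j) \<circ> transpose i (Suc i)"
  by (rule ext) (auto simp: transpose_def)

lemma transpose_braid:
  "transpose i (Suc i) \<circ> transpose (Suc i) (Suc (Suc i)) \<circ> transpose i (Suc i) =
   transpose (Suc i) (Suc (Suc i)) \<circ> transpose i (Suc i) \<circ> transpose (Suc i) (Suc (Suc i))"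
  by (rule ext) (auto simp: transpose_def)

lemma swap_vars_far: "Suc i < j \<Longrightarrow> swap_vars i (swap_vars j f) = swap_vars j (swap_vars i f)"
  unfolding swap_vars_compose by (metis transpose_far)

lemma swap_vars_braid:
  "swap_vars i (swap_vars (Suc i) (swap_vars i f)) =
   swap_vars (Suc i) (swap_vars i (swap_vars (Suc i) f))"
proof -
  let ?s = "transpose i (Suc i)" and ?t = "transpose (Suc i) (Suc (Suc i))"
  let ?m = "Poly_Mapping.map_key :: _ \<Rightarrow> (nat \<Rightarrow>\<^sub>0 nat) \<Rightarrow> _"
  have eq: "?m ?s \<circ> ?m ?t \<circ> ?m ?s = ?m ?t \<circ> ?m ?s \<circ> ?m ?t"
    using transpose_braid[of i] by (intro ext) (simp add: map_key_compose inj_compose o_assoc)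
  then show ?thesis
    unfolding swap_vars_def
    by (simp add: map_key_compose inj_map_key_transpose inj_compose o_assoc)
qed

lemma divided_difference_far:
  assumes "Suc i < j"
  shows "divided_difference i (divided_difference j f) = divided_difference j (divided_difference i f)"
proof -
  let ?a = "X i - X (Suc i)" and ?b = "X j - X (Suc j)"
  let ?g = "divided_difference j f" and ?h = "divided_difference i f"
  have 1: "?b * ?g = f - swap_vars j f"
    and 2: "?a * ?h = f - swap_vars i f"
    and 3: "?a * divided_difference i ?g = ?g - swap_vars i ?g" 
    and 4: "?b * divided_difference j ?h = ?h - swap_vars j ?h"
    by (rule divided_difference_mult)+
  have "swap_vars i ?b = ?b" "swap_vars j ?a = ?a"
    using assms by (simp_all add: swap_vars_diff swap_vars_X transpose_def)
  then have 5: "?b * swap_vars i ?g = swap_vars i f - swap_vars i (swap_vars j f)"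
    and 6: "?a * swap_vars j ?h = swap_vars j f - swap_vars i (swap_vars j f)"
    using arg_cong[OF 1, of "swap_vars i"] arg_cong[OF 2, of "swap_vars j"]
    by (simp_all add: swap_vars_diff swap_vars_mult swap_vars_far[OF assms])
  have "?b * (?a * divided_difference i ?g) = ?a * (?b * divided_difference j ?h)"
    unfolding 3 4 right_diff_distrib 1 2 5 6 by simp
  then have "(?a * ?b) * divided_difference i ?g = (?a * ?b) * divided_difference j ?h"
    by (simp only: mult_ac)
  then show ?thesis by simp
qed

lemma braid_aux1:
  fixes a b c :: "'a :: idom"
  assumes "(a - b) * g = f - f1" "(a - c) * g2 = f2 - f21" "(b - c) * h = g - g2"
    "(b - c) * g12 = f12 - f121" "(a - c) * h1 = g1 - g12" "(b - a) * g1 = f1 - f"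
    "(a - b) * k = h - h1" "a \<noteq> b"
  shows "(a - b) * (b - c) * (a - c) * k = f - f1 - f2 + f21 + f12 - f121"
proof -
  have "(a - b) * ((a - b) * (b - c) * (a - c) * k) = (a - b) * (f - f1 - f2 + f21 + f12 - f121)"
    using assms by algebra
  then show ?thesis using assms by simp
qed

lemma braid_aux2:
  fixes a b c :: "'a :: idom"
  assumes "(b - c) * g = f - f2" "(a - c) * g1 = f1 - f12" "(a - b) * h = g - g1"
    "(a - b) * g21 = f21 - f212" "(a - c) * h2 = g2 - g21" "(c - b) * g2 = f2 - f"
    "(b - c) * k = h - h2" "b \<noteq> c"
  shows "(a - b) * (b - c) * (a - c) * k = f - f1 - f2 + f21 + f12 - f212"
proof -
  have "(b - c) * ((a - b) * (b - c) * (a - c) * k) = (b - c) * (f - f1 - f2 + f21 + f12 - f212)"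
    using assms by algebra
  then show ?thesis using assms by simp
qed

lemma divided_difference_braid:
  "divided_difference i (divided_difference (Suc i) (divided_difference i f)) =
   divided_difference (Suc i) (divided_difference i (divided_difference (Suc i) f))"
proof -
  let ?d = divided_difference and ?s = "swap_vars i" and ?t = "swap_vars (Suc i)"
  let ?a = "X i" and ?b = "X (Suc i)" and ?c = "X (Suc (Suc i))"
  have s: "?s ?a = ?b" "?s ?b = ?a" "?s ?c = ?c" "?t ?a = ?a" "?t ?b = ?c" "?t ?c = ?b"
    by (simp_all add: swap_vars_X transpose_def)
  note m = divided_difference_mult
  have S: "swap_vars k ((p - q) * r) = (swap_vars k p - swap_vars k q) * swap_vars k r" for k p q r
    by (simp add: swap_vars_mult swap_vars_diff)
  let ?g = "?d i f" let ?h = "?d (Suc i) ?g"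
  have g: "(?a - ?b) * ?g = f - ?s f" by (rule m)
  have g2: "(?a - ?c) * ?t ?g = ?t f - ?t (?s f)"
    using arg_cong[OF g, of ?t] unfolding S s swap_vars_diff .
  have g12: "(?b - ?c) * ?s (?t ?g) = ?s (?t f) - ?s (?t (?s f))"
    using arg_cong[OF g2, of ?s] unfolding S s swap_vars_diff .
  have g1: "(?b - ?a) * ?s ?g = ?s f - f"
    using arg_cong[OF g, of ?s] unfolding S s swap_vars_diff swap_vars_swap_vars .
  have h: "(?b - ?c) * ?h = ?g - ?t ?g" by (rule m)
  have h1: "(?a - ?c) * ?s ?h = ?s ?g - ?s (?t ?g)"
    using arg_cong[OF h, of ?s] unfolding S s swap_vars_diff .
  have "?a \<noteq> ?b" by simp
  note A = braid_aux1[OF g g2 h g12 h1 g1 m[of i ?h] this]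
  let ?g' = "?d (Suc i) f" let ?h' = "?d i ?g'"
  have g: "(?b - ?c) * ?g' = f - ?t f" by (rule m)
  have g2: "(?a - ?c) * ?s ?g' = ?s f - ?s (?t f)"
    using arg_cong[OF g, of ?s] unfolding S s swap_vars_diff .
  have g12: "(?a - ?b) * ?t (?s ?g') = ?t (?s f) - ?t (?s (?t f))"
    using arg_cong[OF g2, of ?t] unfolding S s swap_vars_diff .
  have g1: "(?c - ?b) * ?t ?g' = ?t f - f"
    using arg_cong[OF g, of ?t] unfolding S s swap_vars_diff swap_vars_swap_vars .
  have h: "(?a - ?b) * ?h' = ?g' - ?s ?g'" by (rule m)
  have h1: "(?a - ?c) * ?t ?h' = ?t ?g' - ?t (?s ?g')"
    using arg_cong[OF h, of ?t] unfolding S s swap_vars_diff .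
  have "?b \<noteq> ?c" by simp
  note B = braid_aux2[OF g g2 h g12 h1 g1 m[of "Suc i" ?h'] this]
  have "(?a - ?b) * (?b - ?c) * (?a - ?c) * ?d i ?h = (?a - ?b) * (?b - ?c) * (?a - ?c) * ?d (Suc i) ?h'"
    unfolding A B swap_vars_braid ..
  moreover have "(?a - ?b) * (?b - ?c) * (?a - ?c) \<noteq> 0" by simp
  ultimately show ?thesis using mult_left_cancel by blast
qed

inductive schubert_rel :: "nat \<Rightarrow> (nat \<Rightarrow> nat) \<Rightarrow> intpoly \<Rightarrow> bool" for n where
  longest: "schubert_rel n (longest_perm n) (\<Prod>i=1..n. X i ^ (n - i))"
| step: "schubert_rel n w f \<Longrightarrow> 1 \<le> i \<Longrightarrow> i < n \<Longrightarrow> w i > w (Suc i) \<Longrightarrow>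
    schubert_rel n (w \<circ> transpose i (Suc i)) (divided_difference i f)"

lemma permutes_comp_adjacent:
  "w permutes {1..n} \<Longrightarrow> 1 \<le> i \<Longrightarrow> i < n \<Longrightarrow> w \<circ> transpose i (Suc i) permutes {1..n}"
  by (intro permutes_compose permutes_swap_id) auto

lemma longest_perm_permutes: "longest_perm n permutes {1..n}"
  by (rule bij_imp_permutes, rule bij_betw_byWitness[where f' = "longest_perm n"])
     (auto simp: longest_perm_def)

lemma schubert_rel_permutes: "schubert_rel n w f \<Longrightarrow> w permutes {1..n}"
  by (induction rule: schubert_rel.induct)
     (blast intro: longest_perm_permutes permutes_comp_adjacent)+

definition perm_weight :: "nat \<Rightarrow> (nat \<Rightarrow> nat) \<Rightarrow> nat" where
  "perm_weight n w = (\<Sum>a=1..n. a * w a)"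

lemma perm_weight_less:
  assumes "1 \<le> i" "i < n" "w i < w (Suc i)"
  shows "perm_weight n (w \<circ> transpose i (Suc i)) < perm_weight n w"
proof -
  have sp: "(\<Sum>a=1..n. g a) = g i + g (Suc i) + (\<Sum>a\<in>{1..n} - {i, Suc i}. g a)" for g :: "nat \<Rightarrow> nat"
  proof -
    have "{1..n} = {i, Suc i} \<union> ({1..n} - {i, Suc i})" using assms by auto
    then have "sum g {1..n} = sum g {i, Suc i} + sum g ({1..n} - {i, Suc i})"
      by (metis finite_atLeastAtMost finite.emptyI finite.insertI sum.union_disjoint Diff_disjoint finite_Diff)
    then show ?thesis by simp
  qed
  have "(\<Sum>a\<in>{1..n} - {i, Suc i}. a * (w \<circ> transpose i (Suc i)) a) = (\<Sum>a\<in>{1..n} - {i, Suc i}. a * w a)"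
    by (rule sum.cong) (auto simp: transpose_def)
  then show ?thesis using assms unfolding perm_weight_def sp[of "\<lambda>a. a * w a"]
      sp[of "\<lambda>a. a * (w \<circ> transpose i (Suc i)) a"] by simp
qed

lemma no_ascent_imp_longest:
  assumes w: "w permutes {1..n}" and d: "\<And>i. 1 \<le> i \<Longrightarrow> i < n \<Longrightarrow> w i > w (Suc i)"
  shows "w = longest_perm n"
proof
  fix k
  have in1: "w a \<in> {1..n}" if "a \<in> {1..n}" for a using that permutes_in_image[OF w] by blast
  have up: "w (Suc a) + Suc a \<le> n + 1" if "Suc a \<le> n" for a
    using that
  proof (induction a)
    case 0
    then show ?case using in1[of 1] by auto
  next
    case (Suc a)
    then show ?case using d[of "Suc a"] by auto
  qed
  have lo: "w (n - a) \<ge> Suc a" if "a < n" for a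
    using that
  proof (induction a)
    case 0
    then show ?case using in1[of n] by auto
  next
    case (Suc a)
    moreover have "1 \<le> n - Suc a" using Suc.prems by linarith
    ultimately show ?case using d[of "n - Suc a"] by (auto simp: Suc_diff_Suc)
  qed
  show "w k = longest_perm n k"
  proof (cases "k \<in> {1..n}")
    case True
    then show ?thesis using up[of "k - 1"] lo[of "n - k"] by (simp add: longest_perm_def)
  next
    case False
    then have "w k = k" by (rule permutes_not_in[OF w])
    then show ?thesis using False by (auto simp: longest_perm_def)
  qed
qed

lemma schubert_rel_unique:
  assumes "w permutes {1..n}"
  shows "\<exists>!f. schubert_rel n w f"
  using assms
proof (induction "perm_weight n w" arbitrary: w rule: less_induct)
  case less
  let ?t = "\<lambda>i. transpose i (Suc i)"
  define G where "G v = (THE f. schubert_rel n v f)" for v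
  have IH: "schubert_rel n v (G v) \<and> (\<forall>f. schubert_rel n v f \<longrightarrow> f = G v)"
    if "v permutes {1..n}" "perm_weight n v < perm_weight n w" for v
    using less.hyps[OF that(2,1)] unfolding G_def by (metis theI')
  have G_step: "G (v \<circ> ?t i) = divided_difference i (G v)"
    if "v permutes {1..n}" "perm_weight n v < perm_weight n w"
       "perm_weight n (v \<circ> ?t i) < perm_weight n w" "1 \<le> i" "i < n" "v i > v (Suc i)" for v i
    using IH[of v] IH[of "v \<circ> ?t i"] schubert_rel.step[of n v "G v" i]
      permutes_comp_adjacent[of v n i] that by metis
  have inv: "v \<circ> ?t i \<circ> ?t i = v" for v :: "nat \<Rightarrow> nat" and i
    by (simp add: o_assoc[symmetric])
  have main: "divided_difference i (G (w \<circ> ?t i)) = divided_difference j (G (w \<circ> ?t j))"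
    if i: "1 \<le> i" "w i < w (Suc i)" and j: "j < n" "w j < w (Suc j)" and ij: "i < j" for i j
  proof (cases "Suc i < j")
    case True
    let ?v = "w \<circ> ?t i" and ?v' = "w \<circ> ?t j" let ?u = "?v \<circ> ?t j"
    have in_range: "i < n" "1 \<le> j" using i j ij by auto
    have pv: "?v permutes {1..n}" and pv': "?v' permutes {1..n}" and pu: "?u permutes {1..n}"
      using less.prems i j in_range by (blast intro: permutes_comp_adjacent)+
    have u': "?u = ?v' \<circ> ?t i" using transpose_far[OF True] by (simp add: o_assoc[symmetric])
    have wv: "perm_weight n ?v < perm_weight n w" and wv': "perm_weight n ?v' < perm_weight n w"
      using i j ij by (auto intro!: perm_weight_less)
    have "perm_weight n ?u < perm_weight n ?v"
      using i j ij True by (intro perm_weight_less) (auto simp: transpose_def)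
    then have wu: "perm_weight n ?u < perm_weight n w" using wv by simp
    have "?u \<circ> ?t j = ?v" "?u \<circ> ?t i = ?v'" using inv[of ?v j] inv[of ?v' i] u' by simp_all
    moreover have "?u i > ?u (Suc i)" "?u j > ?u (Suc j)"
      using i j ij True by (auto simp: transpose_def)
    ultimately have "G ?v = divided_difference j (G ?u)" "G ?v' = divided_difference i (G ?u)"
      using G_step[OF pu wu, of j] G_step[OF pu wu, of i] wv wv' i j ij by auto
    then show ?thesis using divided_difference_far[OF True] by simp
  next
    case False
    then have ji: "j = Suc i" using ij by simp
    let ?v = "w \<circ> ?t i" let ?x = "?v \<circ> ?t j" let ?u = "?x \<circ> ?t i"
    let ?v' = "w \<circ> ?t j" let ?x' = "?v' \<circ> ?t i"
    have u': "?u = ?x' \<circ> ?t j" using transpose_braid[of i] ji by (simp add: o_assoc[symmetric])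
    have in_range: "i < n" "1 \<le> j" using i j ij by auto
    have p: "?v permutes {1..n}" "?v' permutes {1..n}" "?x permutes {1..n}" "?x' permutes {1..n}"
        "?u permutes {1..n}"
      using less.prems i j in_range by (blast intro: permutes_comp_adjacent)+
    have wv: "perm_weight n ?v < perm_weight n w" and wv': "perm_weight n ?v' < perm_weight n w"
      using i j ij by (auto intro!: perm_weight_less)
    have "perm_weight n ?x < perm_weight n ?v" "perm_weight n ?x' < perm_weight n ?v'"
         "perm_weight n ?u < perm_weight n ?x"
      using i j ji by (auto intro!: perm_weight_less simp: transpose_def)
    then have wx: "perm_weight n ?x < perm_weight n w" "perm_weight n ?x' < perm_weight n w"
        "perm_weight n ?u < perm_weight n w" using wv wv' by auto
    have e: "?u \<circ> ?t i = ?x" "?x \<circ> ?t j = ?v" "?u \<circ> ?t j = ?x'" "?x' \<circ> ?t i = ?v'"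
      using inv[of ?x i] inv[of ?v j] inv[of ?x' j] inv[of ?v' i] u' by simp_all
    have d: "?u i > ?u (Suc i)" "?x j > ?x (Suc j)" "?u j > ?u (Suc j)" "?x' i > ?x' (Suc i)"
      using i j ji by (auto simp: transpose_def)
    have "G ?x = divided_difference i (G ?u)"
      using G_step[of ?u i] p wx d i in_range unfolding e by blast
    moreover have "G ?v = divided_difference j (G ?x)"
      using G_step[of ?x j] p wx wv d j in_range unfolding e by blast
    moreover have "G ?x' = divided_difference j (G ?u)"
      using G_step[of ?u j] p wx d j in_range unfolding e by blast
    moreover have "G ?v' = divided_difference i (G ?x')"
      using G_step[of ?x' i] p wx wv' d i in_range unfolding e by blast
    ultimately show ?thesis using divided_difference_braid[of i] ji by simp
  qed
  have main': "divided_difference i (G (w \<circ> ?t i)) = divided_difference j (G (w \<circ> ?t j))"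
    if "1 \<le> i" "i < n" "w i < w (Suc i)" "1 \<le> j" "j < n" "w j < w (Suc j)" for i j
  proof (cases i j rule: linorder_cases)
    case less
    then show ?thesis using that by (intro main)
  next
    case greater
    then show ?thesis using that by (intro main[symmetric])
  qed simp
  show ?case
  proof (cases "\<exists>i. 1 \<le> i \<and> i < n \<and> w i < w (Suc i)")
    case True
    then obtain i where i: "1 \<le> i" "i < n" "w i < w (Suc i)" by blast
    have pv: "w \<circ> ?t i permutes {1..n}" using less.prems i by (blast intro: permutes_comp_adjacent)
    have wv: "perm_weight n (w \<circ> ?t i) < perm_weight n w" using i by (intro perm_weight_less)
    have "schubert_rel n (w \<circ> ?t i \<circ> ?t i) (divided_difference i (G (w \<circ> ?t i)))"
      using IH[OF pv wv] i by (intro schubert_rel.step) auto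
    then have ex: "schubert_rel n w (divided_difference i (G (w \<circ> ?t i)))" by (simp only: inv)
    moreover have "f = divided_difference i (G (w \<circ> ?t i))" if "schubert_rel n w f" for f
      using that
    proof (cases rule: schubert_rel.cases)
      case longest
      then show ?thesis using i by (simp add: longest_perm_def split: if_splits)
    next
      case (step v g j)
      have v: "v = w \<circ> ?t j" unfolding step(1) inv ..
      have j: "w j < w (Suc j)" using step by simp
      have "v permutes {1..n}" using step by (blast dest: schubert_rel_permutes)
      moreover have "perm_weight n v < perm_weight n w"
        unfolding v using step j by (intro perm_weight_less)
      ultimately have "g = G v" using IH[of v] step(3) by blast
      then have "f = divided_difference j (G (w \<circ> ?t j))" using step(2) v by (simp only:)
      then show ?thesis using main'[OF i step(4,5) j] by (simp only:)
    qed
    ultimately show ?thesis by blast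
  next
    case False
    have "w i > w (Suc i)" if "1 \<le> i" "i < n" for i
    proof -
      have "w i \<noteq> w (Suc i)" using injD[OF permutes_inj[OF less.prems], of i "Suc i"] by auto
      moreover have "\<not> w i < w (Suc i)" using False that by blast
      ultimately show ?thesis by linarith
    qed
    then have w: "w = longest_perm n" using less.prems by (intro no_ascent_imp_longest)
    have "f = (\<Prod>i=1..n. X i ^ (n - i))" if "schubert_rel n w f" for f
      using that
    proof (cases rule: schubert_rel.cases)
      case (step v g j)
      then have "w j < w (Suc j)" "1 \<le> j" "j < n" by simp_all
      then show ?thesis using False by blast
    qed
    then show ?thesis using schubert_rel.longest[of n] w by blast
  qed
qed

lemma divided_difference_mult_symmetric:
  assumes "swap_vars i g = g"
  shows "divided_difference i (X i * g) = g"
  using assms by (intro divided_difference_eqI)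
    (simp add: swap_vars_mult swap_vars_X algebra_simps)

lemma schubert_rel_Suc_longest:
  assumes "k \<le> n"
  shows "schubert_rel (Suc n)
    (\<lambda>i. if i \<in> {1..k} then n + 1 - i else if i = Suc k then Suc n
        else if i \<in> {1..Suc n} then n + 2 - i else i)
    ((\<Prod>i=1..k. X i ^ (n - i)) * (\<Prod>i=Suc k..Suc n. X i ^ (Suc n - i)))"
  using assms
proof (induction k)
  case 0
  have "(\<lambda>i. if i \<in> {1..0::nat} then n + 1 - i else if i = Suc 0 then Suc n
        else if i \<in> {1..Suc n} then n + 2 - i else i) = longest_perm (Suc n)"
    by (auto simp: longest_perm_def)
  then show ?case using schubert_rel.longest[of "Suc n"] by simp
next
  case (Suc k)
  let ?w = "\<lambda>k i. if i \<in> {1..k} then n + 1 - i else if i = Suc k then Suc n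
        else if i \<in> {1..Suc n} then n + 2 - i else i"
  let ?A = "\<Prod>i=1..k. X i ^ (n - i)" and ?B = "\<Prod>i=Suc (Suc (Suc k))..Suc n. X i ^ (Suc n - i)"
  let ?m = "n - Suc k"
  let ?g = "?A * (X (Suc k) ^ ?m * X (Suc (Suc k)) ^ ?m) * ?B"
  have "swap_vars (Suc k) ?A = ?A" "swap_vars (Suc k) ?B = ?B"
    by (auto simp: swap_vars_prod swap_vars_power swap_vars_X transpose_def intro!: prod.cong)
  then have sym: "swap_vars (Suc k) ?g = ?g"
    by (simp add: swap_vars_mult swap_vars_power swap_vars_X mult_ac)
  have m: "Suc n - Suc k = Suc ?m" "Suc n - Suc (Suc k) = ?m" using Suc.prems by auto
  have "(\<Prod>i=Suc k..Suc n. X i ^ (Suc n - i)) = X (Suc k) ^ Suc ?m * (X (Suc (Suc k)) ^ ?m * ?B)"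
    using Suc.prems m by (simp add: prod.atLeast_Suc_atMost del: diff_Suc_Suc)
  then have f: "?A * (\<Prod>i=Suc k..Suc n. X i ^ (Suc n - i)) = X (Suc k) * ?g"
    by (simp add: mult_ac)
  have f': "(\<Prod>i=1..Suc k. X i ^ (n - i)) * (\<Prod>i=Suc (Suc k)..Suc n. X i ^ (Suc n - i)) = ?g"
    using Suc.prems m by (simp add: prod.atLeast_Suc_atMost mult_ac del: diff_Suc_Suc)
  have w: "?w k \<circ> transpose (Suc k) (Suc (Suc k)) = ?w (Suc k)"
    using Suc.prems by (auto simp: transpose_def fun_eq_iff)
  have "schubert_rel (Suc n) (?w k \<circ> transpose (Suc k) (Suc (Suc k))) (divided_difference (Suc k) (X (Suc k) * ?g))"
    using Suc.IH Suc.prems unfolding f by (intro schubert_rel.step) auto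
  then show ?case unfolding w f' divided_difference_mult_symmetric[OF sym] .
qed

lemma schubert_rel_Suc: "schubert_rel n w f \<Longrightarrow> schubert_rel (Suc n) w f"
proof (induction rule: schubert_rel.induct)
  case longest
  have "(\<lambda>i. if i \<in> {1..n} then n + 1 - i else if i = Suc n then Suc n
        else if i \<in> {1..Suc n} then n + 2 - i else i) = longest_perm n"
    by (auto simp: longest_perm_def)
  then show ?case using schubert_rel_Suc_longest[of n n] by simp
qed (blast intro: schubert_rel.step less_SucI)

lemma schubert_rel_mono: "n \<le> m \<Longrightarrow> schubert_rel n w f \<Longrightarrow> schubert_rel m w f"
  by (induction m rule: dec_induct) (auto intro: schubert_rel_Suc)

lemma S_infinity_iff: "w \<in> S_infinity \<longleftrightarrow> (\<exists>n\<ge>1. w permutes {1..n})"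
proof
  assume w: "w \<in> S_infinity"
  then obtain N where N: "\<And>m. w m \<noteq> m \<Longrightarrow> m \<le> N"
    by (auto simp: S_infinity_def finite_nat_set_iff_bounded_le)
  have "w permutes {1..Suc N}"
  proof (rule permutes_superset)
    show "w permutes {1..}" using w by (simp add: S_infinity_def)
    show "w x = x" if "x \<in> {1..} - {1..Suc N}" for x
      using that N[of x] by (cases "w x = x") auto
  qed
  then show "\<exists>n\<ge>1. w permutes {1..n}" by (intro exI[of _ "Suc N"]) simp
next
  assume "\<exists>n\<ge>1. w permutes {1..n}"
  then obtain n where w: "w permutes {1..n}" by blast
  have "w permutes {1..}" using w by (rule permutes_subset) auto
  moreover have "finite {m. w m \<noteq> m}"
    by (rule finite_subset[of _ "{1..n}"]) (use permutes_not_in[OF w] in blast, simp)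
  ultimately show "w \<in> S_infinity" by (simp add: S_infinity_def)
qed

lemma schubert_family_exists: "\<exists>F. is_schubert_family F"
proof
  define F where "F w = (THE f. \<exists>n. schubert_rel n w f)" for w
  have F: "F w = f" if "schubert_rel n w f" for n w f
    unfolding F_def
  proof (rule the_equality)
    fix g assume "\<exists>n. schubert_rel n w g"
    then obtain m where "schubert_rel m w g" by blast
    then have "schubert_rel (max n m) w f" "schubert_rel (max n m) w g"
      using schubert_rel_mono[OF max.cobounded1 that] schubert_rel_mono[OF max.cobounded2] by auto
    then show "g = f"
      using schubert_rel_unique[OF schubert_rel_permutes[of "max n m" w f]] by auto
  qed (use that in blast)
  show "is_schubert_family F"
    unfolding is_schubert_family_def
  proof (intro conjI allI impI ballI)
    fix n :: nat
    show "F (longest_perm n) = (\<Prod>i=1..n. X i ^ (n - i))" by (rule F[OF schubert_rel.longest])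
  next
    fix w i assume w: "w \<in> S_infinity" and i: "1 \<le> i" "w i > w (Suc i)"
    obtain n where "w permutes {1..n}" using w unfolding S_infinity_iff by blast
    then have "w permutes {1..max n (Suc i)}" by (rule permutes_subset) auto
    then obtain f where f: "schubert_rel (max n (Suc i)) w f"
      using schubert_rel_unique by (meson ex1_implies_ex)
    then have "schubert_rel (max n (Suc i)) (w \<circ> transpose i (Suc i)) (divided_difference i f)"
      using i by (intro schubert_rel.step) auto
    then show "F (w \<circ> transpose i (Suc i)) = divided_difference i (F w)" unfolding F[OF f] by (rule F)
  qed
qed

lemma is_schubert_family_schubert: "is_schubert_family schubert"
  unfolding schubert_def using schubert_family_exists by (rule someI_ex)

lemma schubert_unique:
  assumes F: "is_schubert_family F" and w: "w \<in> S_infinity"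
  shows "F w = schubert w"
proof -
  obtain n where n: "n \<ge> 1" "w permutes {1..n}" using w unfolding S_infinity_iff by blast
  have eq: "G w = f" if "is_schubert_family G" "schubert_rel n w f" for G w f
    using that(2)
  proof (induction rule: schubert_rel.induct)
    case longest
    show ?case using that(1) n(1) unfolding is_schubert_family_def by blast
  next
    case (step v f i)
    have "v \<in> S_infinity"
      using schubert_rel_permutes[OF step.hyps(1)] n unfolding S_infinity_iff by blast
    then have "G (v \<circ> transpose i (Suc i)) = divided_difference i (G v)"
      using that(1) step.hyps unfolding is_schubert_family_def by blast
    then show ?case by (simp only: step.IH)
  qed
  obtain f where "schubert_rel n w f" using schubert_rel_unique[OF n(2)] by auto
  then show ?thesis using eq[OF F] eq[OF is_schubert_family_schubert] by simp
qed

end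

theory Submission
  imports Defs
begin

text \<open>
  Write \<open>f w\<close> for the principal specialization of \<open>w\<close> and \<open>c w\<close> for the right-hand side of the
  inequality. Both sides are compared along a recurrence that climbs from \<open>w\<close> to the longest
  permutation, where they are equal to \<open>1\<close>.

  The recurrence is Knutson's cotransition formula, a special case of Monk's rule
  \<open>X r * schubert w = (\<Sum>j>r. schubert (w \<circ> transpose r j)) - (\<Sum>j<r. schubert (w \<circ> transpose j r))\<close>,
  where the sums run over the transpositions that lead to covers of \<open>w\<close> in Bruhat order
  (\<open>monk_rule\<close>). Monk's rule is proved by applying divided differences to the case of a longest
  permutation, where it has a single term on the right and both sides are explicit monomials.
  If \<open>r\<close> is the first position at which \<open>w\<close> differs from the longest permutation of \<open>{1..n}\<close>,
  then the negative terms vanish, and setting all variables to \<open>1\<close> gives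
  \<open>f w = (\<Sum>j\<in>J. f (w \<circ> transpose r j))\<close>, where \<open>J\<close> is the set of all \<open>j > r\<close> such that
  \<open>w \<circ> transpose r j\<close> covers \<open>w\<close> (\<open>principal_specialization_cotransition\<close>).

  It remains to see that \<open>c w \<le> (\<Sum>j\<in>J. c (w \<circ> transpose r j))\<close> (\<open>card_occurrences_le\<close>). Let \<open>e\<close>
  be the position of the value \<open>w r + 1\<close>. Then \<open>e \<in> J\<close>, and passing from \<open>w\<close> to
  \<open>w \<circ> transpose r e\<close> only affects the relative order of the positions \<open>r\<close> and \<open>e\<close>; so it destroys
  only occurrences that begin at \<open>r\<close> and end at \<open>e\<close> (\<open>lost_occurrence\<close>). These are paid for by the
  other summands. Let \<open>p\<close> be the first position after \<open>r\<close> whose value exceeds \<open>w r\<close>; in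
  \<open>w \<circ> transpose r p\<close> the small value \<open>w r\<close> has moved to \<open>p\<close>, so an occurrence that begins at \<open>r\<close>
  turns into one that begins at \<open>p\<close>, provided that it does not use \<open>p\<close> already. A lost occurrence
  \<open>[r, p, e]\<close> is charged to the summand \<open>1\<close> in \<open>c (w \<circ> transpose r p)\<close>. For a lost occurrence
  \<open>[r, p, y, e]\<close> there is some \<open>z \<in> J\<close> with \<open>z \<le> y\<close> and \<open>w z \<le> w y < w p\<close>; it is charged to the summand
  \<open>1\<close> in \<open>c (w \<circ> transpose r z)\<close> if \<open>z = y\<close>, and otherwise to the 132-occurrence \<open>[z, y, e]\<close> of
  \<open>w \<circ> transpose r z\<close>.
\<close>

abbreviation adj :: "nat \<Rightarrow> nat \<Rightarrow> nat" where
  "adj k \<equiv> transpose k (Suc k)"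

section \<open>Divided differences\<close>

lemma divided_difference_add:
  "divided_difference k (f + g) = divided_difference k f + divided_difference k g"
  by (rule divided_difference_eqI)
     (simp add: distrib_left divided_difference_mult swap_vars_add)

lemma divided_difference_0 [simp]: "divided_difference k 0 = 0"
  using divided_difference_add[of k 0 0] by simp

lemma divided_difference_uminus: "divided_difference k (- f) = - divided_difference k f"
  using divided_difference_add[of k f "- f"] by (simp add: add_eq_0_iff)

lemma divided_difference_sum:
  "divided_difference k (\<Sum>a\<in>A. f a) = (\<Sum>a\<in>A. divided_difference k (f a))"
  by (induction A rule: infinite_finite_induct) (simp_all add: divided_difference_add)

lemma divided_difference_symmetric:
  "swap_vars k f = f \<Longrightarrow> divided_difference k f = 0"
  by (rule divided_difference_eqI) simp

lemma swap_vars_divided_difference: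
  "swap_vars k (divided_difference k f) = divided_difference k f"
proof -
  let ?d = "divided_difference k f"
  have "(X k - X (Suc k)) * ?d = f - swap_vars k f" by (rule divided_difference_mult)
  from arg_cong[OF this, of "swap_vars k"]
  have "(X (Suc k) - X k) * swap_vars k ?d = swap_vars k f - f"
    by (simp add: swap_vars_mult swap_vars_diff swap_vars_X)
  then have "(X k - X (Suc k)) * swap_vars k ?d = (X k - X (Suc k)) * ?d"
    unfolding divided_difference_mult by (simp add: algebra_simps)
  then show ?thesis by simp
qed

lemma divided_difference_idem: "divided_difference k (divided_difference k f) = 0"
  by (rule divided_difference_symmetric) (rule swap_vars_divided_difference)

lemma divided_difference_X_mult:
  "divided_difference k (X r * f) = X (adj k r) * divided_difference k f +
     (if r = k then f else if r = Suc k then - f else 0)"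
proof (rule divided_difference_eqI)
  have "(X k - X (Suc k)) * divided_difference k f = f - swap_vars k f"
    by (rule divided_difference_mult)
  then have "X (adj k r) * ((X k - X (Suc k)) * divided_difference k f) =
      X (adj k r) * (f - swap_vars k f)"
    by simp
  then show "(X k - X (Suc k)) * (X (adj k r) * divided_difference k f +
      (if r = k then f else if r = Suc k then - f else 0)) = X r * f - swap_vars k (X r * f)"
    by (auto simp: swap_vars_mult swap_vars_X algebra_simps transpose_def)
qed

text \<open>
  The monomial is \<open>X k\<close> times a monomial in which \<open>X k\<close> and \<open>X (Suc k)\<close> have the same exponent. This
  is the step by which the Schubert monomials of dominant permutations arise from each other.
\<close>

lemma divided_difference_monomial:
  assumes k: "1 \<le> k" "k < N" and e: "e k = Suc (e (Suc k))"
  shows "divided_difference k (\<Prod>i=1..N. X i ^ e i) =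
    (\<Prod>i=1..N. X i ^ (e(k := e (Suc k))) i)"
proof -
  let ?e = "e(k := e (Suc k))"
  let ?g = "\<Prod>i=1..N. X i ^ ?e i"
  have sp: "(\<Prod>i=1..N. h i) = h k * h (Suc k) * (\<Prod>i\<in>{1..N} - {k, Suc k}. h i)"
    for h :: "nat \<Rightarrow> intpoly"
  proof -
    have "(\<Prod>i=1..N. h i) = prod h {k, Suc k} * prod h ({1..N} - {k, Suc k})"
      using k by (subst mult.commute, intro prod.subset_diff) auto
    then show ?thesis by simp
  qed
  have "(\<Prod>i\<in>{1..N} - {k, Suc k}. X i ^ ?e i) = (\<Prod>i\<in>{1..N} - {k, Suc k}. X i ^ e i)"
    by (rule prod.cong) auto
  then have "(\<Prod>i=1..N. X i ^ e i) = X k * ?g"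
    unfolding sp[of "\<lambda>i. X i ^ e i"] sp[of "\<lambda>i. X i ^ ?e i"] by (simp add: e mult_ac)
  moreover have "swap_vars k ?g = ?g"
  proof -
    have "swap_vars k (\<Prod>i\<in>{1..N} - {k, Suc k}. X i ^ ?e i) =
        (\<Prod>i\<in>{1..N} - {k, Suc k}. X i ^ ?e i)"
      unfolding swap_vars_prod
      by (rule prod.cong) (auto simp: swap_vars_power swap_vars_X transpose_def)
    then show ?thesis
      unfolding sp[of "\<lambda>i. X i ^ ?e i"]
      by (simp add: swap_vars_mult swap_vars_power swap_vars_X mult_ac)
  qed
  ultimately show ?thesis by (simp add: divided_difference_mult_symmetric)
qed

section \<open>Schubert polynomials\<close>

lemma S_infinity_inj: "w \<in> S_infinity \<Longrightarrow> inj w"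
  by (auto simp: S_infinity_def intro: permutes_inj)

lemma S_infinity_comp_transpose:
  assumes "w \<in> S_infinity" "1 \<le> i" "1 \<le> j"
  shows "w \<circ> transpose i j \<in> S_infinity"
proof -
  obtain n where n: "1 \<le> n" "w permutes {1..n}" using assms(1) unfolding S_infinity_iff by blast
  have "w permutes {1..n + i + j}" using n(2) by (rule permutes_subset) auto
  then have "w \<circ> transpose i j permutes {1..n + i + j}"
    using assms by (intro permutes_compose permutes_swap_id) auto
  then show ?thesis unfolding S_infinity_iff using n(1) by (intro exI[of _ "n + i + j"]) simp
qed

lemma schubert_longest: "1 \<le> n \<Longrightarrow> schubert (longest_perm n) = (\<Prod>i=1..n. X i ^ (n - i))"
  using is_schubert_family_schubert unfolding is_schubert_family_def by blast

lemma schubert_descent: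
  "w \<in> S_infinity \<Longrightarrow> 1 \<le> k \<Longrightarrow> w k > w (Suc k) \<Longrightarrow>
    schubert (w \<circ> adj k) = divided_difference k (schubert w)"
  using is_schubert_family_schubert unfolding is_schubert_family_def by blast

lemma divided_difference_schubert_ascent:
  assumes "w \<in> S_infinity" "1 \<le> k" "w k < w (Suc k)"
  shows "divided_difference k (schubert w) = 0"
proof -
  have "schubert (w \<circ> adj k \<circ> adj k) = divided_difference k (schubert (w \<circ> adj k))"
    using assms by (intro schubert_descent S_infinity_comp_transpose) auto
  then have "schubert w = divided_difference k (schubert (w \<circ> adj k))"
    by (simp add: comp_assoc)
  then show ?thesis by (metis divided_difference_idem)
qed

text \<open>
  The permutation on the left is dominant, so its Schubert polynomial is the monomial of its
  Lehmer code. It is reached from \<open>longest_perm (Suc n)\<close> by adjacent transpositions: the entry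
  \<open>Suc n\<close> first moves right to position \<open>r\<close>, then the entry \<open>n + 1 - r\<close> behind it moves right to
  the end. All permutations on the way are dominant as well, so each step turns one monomial into
  another.
\<close>

lemma schubert_longest_comp_transpose:
  assumes r: "1 \<le> r" "r \<le> n"
  shows "schubert (longest_perm n \<circ> transpose r (Suc n)) =
    X r * (\<Prod>i=1..n. X i ^ (n - i))"
proof -
  \<comment> \<open>The one-line notation \<open>n, \<dots>, n + 2 - r, n + 1, n - r, \<dots>\<close> in which the entry \<open>n + 1 - r\<close> has
    arrived at position \<open>Suc m\<close>, and its Lehmer code.\<close>
  define u where "u m i = (if 1 \<le> i \<and> i < r then n + 1 - i else if i = r then n + 1
    else if r < i \<and> i \<le> m then n + 1 - i else if i = Suc m then n + 1 - r
    else if Suc m < i \<and> i \<le> Suc n then n + 2 - i else i)" for m i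
  define e where "e m i = (if i < r then n - i else if i = r then n + 1 - r
    else if i \<le> m then n - i else n + 1 - i)" for m i
  have start: "schubert_rel (Suc n) (u r) (\<Prod>i=1..Suc n. X i ^ e r i)"
  proof -
    have *: "schubert_rel (Suc n)
      (\<lambda>i. if i \<in> {1..r - 1} then n + 1 - i else if i = Suc (r - 1) then Suc n
        else if i \<in> {1..Suc n} then n + 2 - i else i)
      ((\<Prod>i=1..r - 1. X i ^ (n - i)) * (\<Prod>i=Suc (r - 1)..Suc n. X i ^ (Suc n - i)))"
      using r by (intro schubert_rel_Suc_longest) auto
    have u: "(\<lambda>i. if i \<in> {1..r - 1} then n + 1 - i else if i = Suc (r - 1) then Suc n
        else if i \<in> {1..Suc n} then n + 2 - i else i) = u r"
      using r by (auto simp: u_def fun_eq_iff)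
    have "(\<Prod>i=1..Suc n. X i ^ e r i) =
        (\<Prod>i=1..r - 1. X i ^ e r i) * (\<Prod>i=Suc (r - 1)..Suc n. X i ^ e r i)"
    proof -
      have "{1..Suc n} = {1..r - 1} \<union> {Suc (r - 1)..Suc n}" using r by auto
      then show ?thesis by (simp only:) (intro prod.union_disjoint, auto)
    qed
    also have "\<dots> = (\<Prod>i=1..r - 1. X i ^ (n - i)) * (\<Prod>i=Suc (r - 1)..Suc n. X i ^ (Suc n - i))"
      by (intro arg_cong2[where f = "(*)"] prod.cong) (use r in \<open>auto simp: e_def\<close>)
    finally show ?thesis using * unfolding u by simp
  qed
  have rel: "m \<le> n \<Longrightarrow> schubert_rel (Suc n) (u m) (\<Prod>i=1..Suc n. X i ^ e m i)" if "r \<le> m" for m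
    using that
  proof (induction m rule: dec_induct)
    case base
    show ?case by (rule start)
  next
    case (step m)
    have "schubert_rel (Suc n) (u m \<circ> adj (Suc m))
        (divided_difference (Suc m) (\<Prod>i=1..Suc n. X i ^ e m i))"
    proof (rule schubert_rel.step)
      show "schubert_rel (Suc n) (u m) (\<Prod>i=1..Suc n. X i ^ e m i)"
        by (rule step.IH) (use step.prems in simp)
    qed (use step r in \<open>auto simp: u_def\<close>)
    moreover have "u m \<circ> adj (Suc m) = u (Suc m)"
      using step r by (auto simp: u_def fun_eq_iff transpose_def)
    moreover have "divided_difference (Suc m) (\<Prod>i=1..Suc n. X i ^ e m i) =
        (\<Prod>i=1..Suc n. X i ^ ((e m)(Suc m := e m (Suc (Suc m)))) i)"
      using step r by (intro divided_difference_monomial) (auto simp: e_def)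
    moreover have "(e m)(Suc m := e m (Suc (Suc m))) = e (Suc m)"
      using step r by (auto simp: e_def fun_eq_iff)
    ultimately show ?case by (simp only:)
  qed
  have schub: "schubert w = f" if "schubert_rel (Suc n) w f" for w f
    using that
  proof (induction rule: schubert_rel.induct)
    case longest
    show ?case by (rule schubert_longest) simp
  next
    case (step v f i)
    have "v \<in> S_infinity"
      using schubert_rel_permutes[OF step.hyps(1)] unfolding S_infinity_iff
      by (intro exI[of _ "Suc n"]) simp
    then have "schubert (v \<circ> adj i) = divided_difference i (schubert v)"
      using step.hyps by (intro schubert_descent)
    then show ?case by (simp only: step.IH)
  qed
  have "schubert (u n) = (\<Prod>i=1..Suc n. X i ^ e n i)"
    by (rule schub[OF rel]) (use r in auto)
  also have "u n = longest_perm n \<circ> transpose r (Suc n)"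
    using r by (auto simp: u_def longest_perm_def fun_eq_iff transpose_def)
  also have "(\<Prod>i=1..Suc n. X i ^ e n i) = X r * (\<Prod>i=1..n. X i ^ (n - i))"
  proof -
    have "(\<Prod>i=1..Suc n. X i ^ e n i) = (\<Prod>i=1..n. X i ^ e n i)"
      using r by (simp add: e_def)
    also have "\<dots> = (\<Prod>i=1..n. (if i = r then X r else 1) * X i ^ (n - i))"
      by (rule prod.cong) (auto simp: e_def Suc_diff_le)
    also have "\<dots> = X r * (\<Prod>i=1..n. X i ^ (n - i))"
      using r by (simp add: prod.distrib)
    finally show ?thesis .
  qed
  finally show ?thesis .
qed

section \<open>Monk's rule\<close>

text \<open>
  For \<open>w \<in> S_infinity\<close> and \<open>i \<ge> 1\<close> this says that \<open>w \<circ> transpose i j\<close> covers \<open>w\<close> in the strong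
  Bruhat order, that is, has exactly one inversion more, and that \<open>i < j\<close>.
\<close>

definition bruhat_cover :: "(nat \<Rightarrow> nat) \<Rightarrow> nat \<Rightarrow> nat \<Rightarrow> bool" where
  "bruhat_cover w i j \<longleftrightarrow>
    i < j \<and> w i < w j \<and> (\<forall>m. i < m \<longrightarrow> m < j \<longrightarrow> w i < w m \<longrightarrow> \<not> w m < w j)"

text \<open>
  Putting the sign into the summand makes the two sums of Monk's rule one sum over all \<open>j\<close>, which an
  adjacent transposition permutes.
\<close>

definition monk_term :: "(nat \<Rightarrow> nat) \<Rightarrow> nat \<Rightarrow> nat \<Rightarrow> intpoly" where
  "monk_term w r j =
    (if bruhat_cover w r j then schubert (w \<circ> transpose r j)
     else if bruhat_cover w j r then - schubert (w \<circ> transpose r j) else 0)"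

lemma adj_less:
  assumes "i < j" "\<not> (i = k \<and> j = Suc k)"
  shows "adj k i < adj k j"
  using assms by (auto simp: transpose_def)

text \<open>
  Covers of \<open>w \<circ> adj k\<close>, other than \<open>w\<close> itself, arise from those covers of \<open>w\<close> that still have a
  descent at \<open>k\<close>. The positions strictly between \<open>i\<close> and \<open>j\<close> change only when \<open>i\<close> or \<open>j\<close> is \<open>k\<close> or
  \<open>Suc k\<close>. Losing a position is harmless, because its value cannot lie between \<open>w i\<close> and \<open>w j\<close>;
  gaining one is the condition that the descent at \<open>k\<close> persists.
\<close>

lemma bruhat_cover_comp_adj:
  assumes inj: "inj w" and desc: "w k > w (Suc k)" and ij: "\<not> (i = k \<and> j = Suc k)" "i < j"
  shows "bruhat_cover (w \<circ> adj k) (adj k i) (adj k j) \<longleftrightarrow>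
    bruhat_cover w i j \<and> (w \<circ> transpose i j) k > (w \<circ> transpose i j) (Suc k)"
proof -
  have *: "(\<forall>m. adj k i < m \<longrightarrow> m < adj k j \<longrightarrow> P (adj k m)) \<longleftrightarrow>
      (\<forall>m. adj k i < adj k m \<longrightarrow> adj k m < adj k j \<longrightarrow> P m)" for P
  proof (intro iffI allI impI)
    fix m assume "\<forall>m. adj k i < m \<longrightarrow> m < adj k j \<longrightarrow> P (adj k m)" "adj k i < adj k m" "adj k m < adj k j"
    then have "P (adj k (adj k m))" by blast
    then show "P m" by simp
  next
    fix m assume "\<forall>m. adj k i < adj k m \<longrightarrow> adj k m < adj k j \<longrightarrow> P m" "adj k i < m" "m < adj k j"
    then show "P (adj k m)" by simp
  qed
  have L: "bruhat_cover (w \<circ> adj k) (adj k i) (adj k j) \<longleftrightarrow> w i < w j \<and>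
      (\<forall>m. adj k i < adj k m \<longrightarrow> adj k m < adj k j \<longrightarrow> w i < w m \<longrightarrow> \<not> w m < w j)"
    using adj_less[OF ij(2,1)] unfolding bruhat_cover_def
    by (simp add: *[of "\<lambda>m. w i < w m \<longrightarrow> \<not> w m < w j"])
  have ne: "w a = w b \<longleftrightarrow> a = b" for a b using inj by (simp add: inj_eq)
  consider (a) "i \<noteq> k" "i \<noteq> Suc k" "j \<noteq> k" "j \<noteq> Suc k" | (b) "i = k" "Suc k < j"
    | (c) "i = Suc k" "Suc k < j" | (d) "i < k" "j = k" | (e) "i < k" "j = Suc k"
    using ij by linarith
  then show ?thesis
  proof cases
    case a
    then have "adj k i < adj k m \<longleftrightarrow> i < m" "adj k m < adj k j \<longleftrightarrow> m < j" for m
      by (auto simp: transpose_def)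
    then show ?thesis unfolding L using a ij desc by (auto simp: bruhat_cover_def transpose_def)
  next
    case b
    then have "adj k i < adj k m \<and> adj k m < adj k j \<longleftrightarrow> k < m \<and> m < j \<and> m \<noteq> Suc k" for m
      by (auto simp: transpose_def)
    then have "bruhat_cover (w \<circ> adj k) (adj k i) (adj k j) \<longleftrightarrow> w i < w j \<and>
      (\<forall>m. k < m \<and> m < j \<and> m \<noteq> Suc k \<longrightarrow> w i < w m \<longrightarrow> \<not> w m < w j)"
      unfolding L by blast
    also have "\<dots> \<longleftrightarrow> bruhat_cover w i j \<and> w (Suc k) < w j"
    proof -
      have "\<not> w k < w (Suc k)" using desc by simp
      then have "w k < w m \<Longrightarrow> m \<noteq> Suc k" for m by blast
      then show ?thesis using b desc unfolding bruhat_cover_def by auto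
    qed
    finally show ?thesis using b by (simp add: transpose_def)
  next
    case c
    then have "adj k i < adj k m \<and> adj k m < adj k j \<longleftrightarrow> m = k \<or> Suc k < m \<and> m < j" for m
      by (auto simp: transpose_def)
    then have "bruhat_cover (w \<circ> adj k) (adj k i) (adj k j) \<longleftrightarrow> w i < w j \<and>
      (\<forall>m. m = k \<or> Suc k < m \<and> m < j \<longrightarrow> w i < w m \<longrightarrow> \<not> w m < w j)"
      unfolding L by blast
    also have "\<dots> \<longleftrightarrow> bruhat_cover w i j \<and> w j < w k"
    proof -
      have "w i < w k" "\<not> w k < w j \<longleftrightarrow> w j < w k" using c desc ne[of j k] by auto
      then show ?thesis using c unfolding bruhat_cover_def by auto
    qed
    finally show ?thesis using c by (simp add: transpose_def)
  next
    case d
    then have "adj k i < adj k m \<and> adj k m < adj k j \<longleftrightarrow> m = Suc k \<or> i < m \<and> m < j" for m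
      by (auto simp: transpose_def)
    then have "bruhat_cover (w \<circ> adj k) (adj k i) (adj k j) \<longleftrightarrow> w i < w j \<and>
      (\<forall>m. m = Suc k \<or> i < m \<and> m < j \<longrightarrow> w i < w m \<longrightarrow> \<not> w m < w j)"
      unfolding L by blast
    also have "\<dots> \<longleftrightarrow> bruhat_cover w i j \<and> w (Suc k) < w i"
    proof -
      have "w (Suc k) < w j" "\<not> w i < w (Suc k) \<longleftrightarrow> w (Suc k) < w i"
        using d desc ne[of i "Suc k"] by auto
      then show ?thesis using d unfolding bruhat_cover_def by auto
    qed
    finally show ?thesis using d by (simp add: transpose_def)
  next
    case e
    then have "adj k i < adj k m \<and> adj k m < adj k j \<longleftrightarrow> i < m \<and> m < j \<and> m \<noteq> k" for m
      by (auto simp: transpose_def)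
    then have "bruhat_cover (w \<circ> adj k) (adj k i) (adj k j) \<longleftrightarrow> w i < w j \<and>
      (\<forall>m. i < m \<and> m < j \<and> m \<noteq> k \<longrightarrow> w i < w m \<longrightarrow> \<not> w m < w j)"
      unfolding L by blast
    also have "\<dots> \<longleftrightarrow> bruhat_cover w i j \<and> w i < w k"
    proof -
      have "\<not> w k < w j" using desc e by simp
      then have "w m < w j \<Longrightarrow> m \<noteq> k" for m by blast
      then show ?thesis using e desc unfolding bruhat_cover_def by auto
    qed
    finally show ?thesis using e by (simp add: transpose_def)
  qed
qed

lemma transpose_comp_adj:
  "w \<circ> adj k \<circ> transpose (adj k r) (adj k j) = w \<circ> transpose r j \<circ> adj k"
  by (auto simp: fun_eq_iff transpose_def)

text \<open>
  If the cover loses the descent at \<open>k\<close>, then its Schubert polynomial is itself a divided difference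
  and is killed by applying another one; in that case the right-hand side is not a cover.
\<close>

lemma divided_difference_monk_term:
  assumes w: "w \<in> S_infinity" and k: "1 \<le> k" "w k > w (Suc k)"
    and rj: "1 \<le> r" "1 \<le> j" "{r, j} \<noteq> {k, Suc k}"
  shows "divided_difference k (monk_term w r j) = monk_term (w \<circ> adj k) (adj k r) (adj k j)"
proof -
  let ?v = "w \<circ> transpose r j"
  have v: "?v \<in> S_infinity" using w rj by (intro S_infinity_comp_transpose)
  have vne: "?v k \<noteq> ?v (Suc k)" using S_infinity_inj[OF v] by (metis injD n_not_Suc_n)
  have inj: "inj w" using w by (rule S_infinity_inj)
  have c: "bruhat_cover (w \<circ> adj k) (adj k r) (adj k j) \<longleftrightarrow>
      bruhat_cover w r j \<and> ?v k > ?v (Suc k)" if "r < j"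
    using bruhat_cover_comp_adj[OF inj k(2) _ that] rj(3) by auto
  have c': "bruhat_cover (w \<circ> adj k) (adj k j) (adj k r) \<longleftrightarrow>
      bruhat_cover w j r \<and> ?v k > ?v (Suc k)" if "j < r"
    using bruhat_cover_comp_adj[OF inj k(2) _ that] rj(3) by (auto simp: transpose_commute)
  have less: "bruhat_cover w a b \<Longrightarrow> a < b" for w a b by (simp add: bruhat_cover_def)
  have S: "schubert (w \<circ> adj k \<circ> transpose (adj k r) (adj k j)) = divided_difference k (schubert ?v)"
    if "?v k > ?v (Suc k)"
    unfolding transpose_comp_adj by (rule schubert_descent[OF v k(1) that])
  have Z: "divided_difference k (schubert ?v) = 0" if "\<not> ?v k > ?v (Suc k)"
    using that vne by (intro divided_difference_schubert_ascent[OF v k(1)]) linarith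
  consider "r < j" | "j < r" | "r = j" by linarith
  then show ?thesis
  proof cases
    case 1
    then have n: "\<not> bruhat_cover w j r" "\<not> bruhat_cover (w \<circ> adj k) (adj k j) (adj k r)"
      using less adj_less[of r j k] rj(3) by (fastforce dest: less)+
    show ?thesis unfolding monk_term_def using n c[OF 1] S Z by (cases "?v k > ?v (Suc k)") auto
  next
    case 2
    then have n: "\<not> bruhat_cover w r j" "\<not> bruhat_cover (w \<circ> adj k) (adj k r) (adj k j)"
      using less adj_less[of j r k] rj(3) by (fastforce dest: less)+
    show ?thesis unfolding monk_term_def using n c'[OF 2] S Z
      by (cases "?v k > ?v (Suc k)") (auto simp: divided_difference_uminus)
  next
    case 3
    then show ?thesis by (simp add: monk_term_def bruhat_cover_def)
  qed
qed

text \<open>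
  The induction descends from the longest permutation and treats all \<open>r\<close> at once, because the
  divided difference \<open>k\<close> turns the factor \<open>X r\<close> into \<open>X (adj k r)\<close>. The extra term \<open>\<plusminus> schubert w\<close>
  of the Leibniz rule for \<open>r = k\<close> or \<open>r = Suc k\<close> is the summand of the new cover that leads from
  \<open>w \<circ> adj k\<close> back to \<open>w\<close>.
\<close>

theorem monk_rule:
  assumes "w permutes {1..n}" and "1 \<le> n" and r: "1 \<le> r" "r \<le> n"
  shows "X r * schubert w = (\<Sum>j=1..Suc n. monk_term w r j)"
proof -
  obtain f where "schubert_rel n w f" using schubert_rel_unique[OF assms(1)] by blast
  then show ?thesis using r
  proof (induction arbitrary: r rule: schubert_rel.induct)
    case longest
    let ?w = "longest_perm n"
    have "monk_term ?w r j = 0" if "j \<in> {1..n}" for j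
      using that longest by (auto simp: monk_term_def bruhat_cover_def longest_perm_def)
    moreover have "bruhat_cover ?w r (Suc n)"
      using longest by (auto simp: bruhat_cover_def longest_perm_def)
    ultimately show ?case
      using schubert_longest[OF assms(2)] schubert_longest_comp_transpose[of r n] longest
      by (simp add: monk_term_def)
  next
    case (step w f k)
    have w: "w \<in> S_infinity"
      using schubert_rel_permutes[OF step.hyps(1)] assms(2) unfolding S_infinity_iff by blast
    define q where "q = adj k r"
    have q: "1 \<le> q" "q \<le> n" "adj k q = r"
      using step.prems step.hyps by (auto simp: q_def transpose_def)
    \<comment> \<open>The term of the Leibniz rule in which \<open>X q\<close> itself is differentiated.\<close>
    define corr where "corr = (if q = k then schubert w else if q = Suc k then - schubert w else 0)"
    have IH: "X q * schubert w = (\<Sum>j=1..Suc n. monk_term w q j)" using step.IH q by blast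
    have dd: "schubert (w \<circ> adj k) = divided_difference k (schubert w)"
      using w step.hyps by (intro schubert_descent)
    have bij: "bij_betw (adj k) {1..Suc n} {1..Suc n}"
      using step.hyps by (intro permutes_imp_bij permutes_swap_id) auto
    have summand: "monk_term (w \<circ> adj k) r (adj k j) =
        divided_difference k (monk_term w q j) - (if j = adj k q then corr else 0)"
      if j: "j \<in> {1..Suc n}" for j
    proof (cases "{q, j} = {k, Suc k}")
      case False
      have "corr = 0" if "j = adj k q"
      proof -
        have "q \<noteq> k" "q \<noteq> Suc k" using False that by auto
        then show ?thesis by (simp add: corr_def)
      qed
      moreover have "1 \<le> j" using j by simp
      ultimately show ?thesis
        using divided_difference_monk_term[OF w step.hyps(2,4) q(1) _ False] q(3) by simp
    next
      case True
      then have qj: "q = k \<and> j = Suc k \<or> q = Suc k \<and> j = k" by (auto simp: doubleton_eq_iff)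
      have inv: "w \<circ> adj k \<circ> adj k = w" by (simp add: comp_assoc)
      have cover: "bruhat_cover (w \<circ> adj k) k (Suc k)" "\<not> bruhat_cover (w \<circ> adj k) (Suc k) k"
        "\<not> bruhat_cover w (Suc k) k" "\<not> bruhat_cover w k (Suc k)"
        using step.hyps(4) by (auto simp: bruhat_cover_def)
      from qj show ?thesis
      proof (elim disjE conjE)
        assume qj: "q = k" "j = Suc k"
        then have "r = Suc k" using q(3) by simp
        then show ?thesis
          using qj inv cover by (simp add: monk_term_def corr_def transpose_commute[of "Suc k"])
      next
        assume qj: "q = Suc k" "j = k"
        then have "r = k" using q(3) by simp
        then show ?thesis
          using qj inv cover by (simp add: monk_term_def corr_def transpose_commute[of "Suc k"])
      qed
    qed
    have "adj k q \<in> {1..Suc n}" using q step.prems by simp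
    then have delta: "(\<Sum>j=1..Suc n. if j = adj k q then corr else 0) = corr"
      by (simp only: sum.delta finite_atLeastAtMost if_True)
    have "(\<Sum>j=1..Suc n. monk_term (w \<circ> adj k) r j) =
        (\<Sum>j=1..Suc n. monk_term (w \<circ> adj k) r (adj k j))"
      by (rule sum.reindex_bij_betw[OF bij, symmetric])
    also have "\<dots> = (\<Sum>j=1..Suc n. divided_difference k (monk_term w q j) -
        (if j = adj k q then corr else 0))"
      by (rule sum.cong[OF refl summand])
    also have "\<dots> = divided_difference k (X q * schubert w) - corr"
      unfolding IH divided_difference_sum sum_subtractf delta ..
    also have "\<dots> = X r * schubert (w \<circ> adj k)"
      unfolding divided_difference_X_mult dd q(3) corr_def by simp
    finally show ?case by (rule sym)
  qed
qed

section \<open>Principal specialization\<close>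

lemma eval_one_superset:
  assumes "finite A" "Poly_Mapping.keys f \<subseteq> A"
  shows "eval_poly (\<lambda>_. 1) f = (\<Sum>m\<in>A. Poly_Mapping.lookup f m)"
  unfolding eval_poly_def using assms
  by (simp, intro sum.mono_neutral_left) (auto simp: in_keys_iff)

lemma eval_one_add: "eval_poly (\<lambda>_. 1) (f + g) = eval_poly (\<lambda>_. 1) f + eval_poly (\<lambda>_. 1) g"
proof -
  let ?A = "Poly_Mapping.keys f \<union> Poly_Mapping.keys g"
  have "Poly_Mapping.keys (f + g) \<subseteq> ?A" by (rule Poly_Mapping.keys_add)
  then show ?thesis
    by (simp add: eval_one_superset[of ?A] lookup_add sum.distrib)
qed

lemma eval_one_0 [simp]: "eval_poly (\<lambda>_. 1) 0 = 0"
  by (simp add: eval_poly_def)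

lemma eval_one_sum:
  "eval_poly (\<lambda>_. 1) (\<Sum>a\<in>A. f a) = (\<Sum>a\<in>A. eval_poly (\<lambda>_. 1) (f a))"
  by (induction A rule: infinite_finite_induct) (simp_all add: eval_one_add)

lemma eval_one_single: "eval_poly (\<lambda>_. 1) (Poly_Mapping.single m c) = c"
  by (simp add: eval_one_superset[of "{m}"])

lemma eval_one_X_mult: "eval_poly (\<lambda>_. 1) (X r * f) = eval_poly (\<lambda>_. 1) f"
proof (induction f rule: intpoly_induct)
  case (single m c)
  show ?case by (simp add: X_def mult_single eval_one_single)
next
  case (add f g)
  then show ?case by (simp add: distrib_left eval_one_add)
qed

lemma principal_specialization_longest:
  assumes "1 \<le> n"
  shows "principal_specialization (longest_perm n) = 1"
proof -
  have pow: "eval_poly (\<lambda>_. 1) (X r ^ k * f) = eval_poly (\<lambda>_. 1) f" for r k f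
    by (induction k) (simp_all add: eval_one_X_mult mult.assoc)
  have "eval_poly (\<lambda>_. 1) (\<Prod>i\<in>A. X i ^ e i) = 1" if "finite A" for A and e :: "nat \<Rightarrow> nat"
    using that
  proof (induction A)
    case empty
    show ?case using eval_one_single[of 0 1] by simp
  qed (simp add: pow)
  then show ?thesis
    unfolding principal_specialization_def schubert_longest[OF assms] by simp
qed

text \<open>
  No \<open>j < r\<close> contributes to Monk's rule, because the prefix has larger values than \<open>w r\<close>. Nor does
  \<open>j = Suc n\<close>, because the value \<open>n + 1 - r > w r\<close> occurs at a position between \<open>r\<close> and \<open>Suc n\<close>.
\<close>

theorem principal_specialization_cotransition:
  assumes w: "w permutes {1..n}" and r: "1 \<le> r" "r \<le> n"
    and prefix: "\<And>i. 1 \<le> i \<Longrightarrow> i < r \<Longrightarrow> w i = n + 1 - i" and wr: "w r < n + 1 - r"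
  shows "principal_specialization w =
    (\<Sum>j | j \<le> n \<and> bruhat_cover w r j. principal_specialization (w \<circ> transpose r j))"
proof -
  let ?ev = "eval_poly (\<lambda>_. 1)"
  let ?J = "{j. j \<le> n \<and> bruhat_cover w r j}"
  have last: "\<not> bruhat_cover w r (Suc n)"
  proof
    assume c: "bruhat_cover w r (Suc n)"
    obtain m where m: "w m = n + 1 - r" using permutes_surj[OF w] by (metis surjD)
    have mn: "m \<in> {1..n}" using m r permutes_in_image[OF w, of m] by auto
    have "\<not> m < r" using prefix[of m] m mn by auto
    moreover have "m \<noteq> r" using m wr by auto
    ultimately have "r < m" "m < Suc n" using mn by auto
    moreover have "w (Suc n) = Suc n" using w by (rule permutes_not_in) simp
    then have "w r < w m" "w m < w (Suc n)" using m wr r by auto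
    ultimately show False using c unfolding bruhat_cover_def by blast
  qed
  have no_low: "\<not> bruhat_cover w j r" if "1 \<le> j" for j
    using prefix[of j] that wr unfolding bruhat_cover_def by auto
  have "?ev (schubert w) = ?ev (\<Sum>j=1..Suc n. monk_term w r j)"
    using monk_rule[OF w _ r] r eval_one_X_mult by (metis order_trans)
  also have "\<dots> = (\<Sum>j=1..Suc n. ?ev (monk_term w r j))" by (rule eval_one_sum)
  also have "\<dots> = (\<Sum>j\<in>?J. ?ev (schubert (w \<circ> transpose r j)))"
  proof (rule sum.mono_neutral_cong_right)
    show "?J \<subseteq> {1..Suc n}" using r by (auto simp: bruhat_cover_def)
    show "\<forall>j\<in>{1..Suc n} - ?J. ?ev (monk_term w r j) = 0"
    proof
      fix j assume j: "j \<in> {1..Suc n} - ?J"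
      then have "\<not> bruhat_cover w r j" using last by (cases "j = Suc n") auto
      then show "?ev (monk_term w r j) = 0" using no_low[of j] j by (simp add: monk_term_def)
    qed
  qed (auto simp: monk_term_def)
  finally show ?thesis unfolding principal_specialization_def .
qed

section \<open>Counting pattern occurrences\<close>

text \<open>The empty tuple stands for the summand \<open>1\<close> of the lower bound.\<close>

definition occurrences :: "(nat \<Rightarrow> nat) \<Rightarrow> nat list set" where
  "occurrences w =
    insert [] (pattern_occurrences [1,3,2] w \<union> pattern_occurrences [1,4,3,2] w)"

lemma pattern_occurrences_132_iff:
  assumes "inj w"
  shows "\<alpha> \<in> pattern_occurrences [1,3,2] w \<longleftrightarrow>
    (\<exists>x y z. \<alpha> = [x, y, z] \<and> 1 \<le> x \<and> x < y \<and> y < z \<and> w x < w z \<and> w z < w y)"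
proof -
  have len: "length \<alpha> = Suc (Suc (Suc 0)) \<longleftrightarrow> (\<exists>x y z. \<alpha> = [x, y, z])"
    by (auto simp: length_Suc_conv)
  have all: "(\<forall>i j. i < j \<and> j < Suc (Suc (Suc 0)) \<longrightarrow> P i j) \<longleftrightarrow>
      P 0 (Suc 0) \<and> P 0 (Suc (Suc 0)) \<and> P (Suc 0) (Suc (Suc 0))" for P :: "nat \<Rightarrow> nat \<Rightarrow> bool"
    by (auto simp: less_Suc_eq)
  have not_less: "\<not> w y < w z \<longleftrightarrow> w z < w y" if "y < z" for y z
    using that injD[OF assms, of y z] by (cases "w y" "w z" rule: linorder_cases) auto
  have "\<alpha> \<in> pattern_occurrences [1,3,2] w \<longleftrightarrow>
    (\<exists>x y z. \<alpha> = [x, y, z] \<and> 1 \<le> x \<and> x < y \<and> y < z \<and> w x < w y \<and> w x < w z \<and> \<not> w y < w z)"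
    unfolding pattern_occurrences_def mem_Collect_eq list.size add_0 add_0_right add_Suc_right len all
    by auto
  moreover have "1 \<le> x \<and> x < y \<and> y < z \<and> w x < w y \<and> w x < w z \<and> \<not> w y < w z \<longleftrightarrow>
      1 \<le> x \<and> x < y \<and> y < z \<and> w x < w z \<and> w z < w y" for x y z
    using not_less[of y z] by auto
  ultimately show ?thesis by (simp only:)
qed

lemma pattern_occurrences_1432_iff:
  assumes "inj w"
  shows "\<alpha> \<in> pattern_occurrences [1,4,3,2] w \<longleftrightarrow>
    (\<exists>x y z t. \<alpha> = [x, y, z, t] \<and> 1 \<le> x \<and> x < y \<and> y < z \<and> z < t \<and>
      w x < w t \<and> w t < w z \<and> w z < w y)"
proof -
  have len: "length \<alpha> = Suc (Suc (Suc (Suc 0))) \<longleftrightarrow> (\<exists>x y z t. \<alpha> = [x, y, z, t])"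
    by (auto simp: length_Suc_conv)
  have all: "(\<forall>i j. i < j \<and> j < Suc (Suc (Suc (Suc 0))) \<longrightarrow> P i j) \<longleftrightarrow>
      P 0 (Suc 0) \<and> P 0 (Suc (Suc 0)) \<and> P (Suc 0) (Suc (Suc 0)) \<and>
      P 0 (Suc (Suc (Suc 0))) \<and> P (Suc 0) (Suc (Suc (Suc 0))) \<and> P (Suc (Suc 0)) (Suc (Suc (Suc 0)))"
    for P :: "nat \<Rightarrow> nat \<Rightarrow> bool"
    by (auto simp: less_Suc_eq)
  have not_less: "\<not> w y < w z \<longleftrightarrow> w z < w y" if "y < z" for y z
    using that injD[OF assms, of y z] by (cases "w y" "w z" rule: linorder_cases) auto
  have "\<alpha> \<in> pattern_occurrences [1,4,3,2] w \<longleftrightarrow>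
    (\<exists>x y z t. \<alpha> = [x, y, z, t] \<and> 1 \<le> x \<and> x < y \<and> y < z \<and> z < t \<and> w x < w y \<and> w x < w z \<and>
      \<not> w y < w z \<and> w x < w t \<and> \<not> w y < w t \<and> \<not> w z < w t)"
    unfolding pattern_occurrences_def mem_Collect_eq list.size add_0 add_0_right add_Suc_right len all
    by auto
  moreover have "1 \<le> x \<and> x < y \<and> y < z \<and> z < t \<and> w x < w y \<and> w x < w z \<and>
      \<not> w y < w z \<and> w x < w t \<and> \<not> w y < w t \<and> \<not> w z < w t \<longleftrightarrow>
      1 \<le> x \<and> x < y \<and> y < z \<and> z < t \<and> w x < w t \<and> w t < w z \<and> w z < w y" for x y z t
    using not_less[of y z] not_less[of z t] by auto
  ultimately show ?thesis by (simp only:)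
qed

lemma occurrences_iff:
  assumes "inj w"
  shows "\<alpha> \<in> occurrences w \<longleftrightarrow> \<alpha> = [] \<or>
    (\<exists>x y z. \<alpha> = [x, y, z] \<and> 1 \<le> x \<and> x < y \<and> y < z \<and> w x < w z \<and> w z < w y) \<or>
    (\<exists>x y z t. \<alpha> = [x, y, z, t] \<and> 1 \<le> x \<and> x < y \<and> y < z \<and> z < t \<and>
      w x < w t \<and> w t < w z \<and> w z < w y)"
  unfolding occurrences_def insert_iff Un_iff
    pattern_occurrences_132_iff[OF assms] pattern_occurrences_1432_iff[OF assms] ..

lemma finite_occurrences: "w \<in> S_infinity \<Longrightarrow> finite (occurrences w)"
  unfolding occurrences_def
  by (auto intro!: finite_pattern_occurrences[where j = 1])

lemma card_occurrences:
  assumes "w \<in> S_infinity"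
  shows "card (occurrences w) = 1 + pattern_count [1,3,2] w + pattern_count [1,4,3,2] w"
proof -
  have "finite (pattern_occurrences [1,3,2] w)" "finite (pattern_occurrences [1,4,3,2] w)"
    by (auto intro!: finite_pattern_occurrences[where j = 1] assms)
  moreover have "pattern_occurrences [1,3,2] w \<inter> pattern_occurrences [1,4,3,2] w = {}"
    "[] \<notin> pattern_occurrences [1,3,2] w \<union> pattern_occurrences [1,4,3,2] w"
    by (auto simp: pattern_occurrences_def)
  ultimately show ?thesis
    by (simp add: occurrences_def pattern_count_def card_Un_disjoint)
qed

text \<open>
  The values of \<open>w\<close> at \<open>r\<close> and \<open>e\<close> are consecutive, so exchanging them preserves every comparison
  except that between \<open>r\<close> and \<open>e\<close>. A lost occurrence hence contains both positions, in the roles of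
  two consecutive values in increasing order: those are the first and the last position in each of
  the two patterns.
\<close>

lemma lost_occurrence:
  assumes inj: "inj w" and e: "r < e" "w e = Suc (w r)"
    and \<alpha>: "\<alpha> \<in> occurrences w" "\<alpha> \<notin> occurrences (w \<circ> transpose r e)"
  shows "(\<exists>x. \<alpha> = [r, x, e] \<and> r < x \<and> x < e \<and> w e < w x) \<or>
    (\<exists>x y. \<alpha> = [r, x, y, e] \<and> r < x \<and> x < y \<and> y < e \<and> w e < w y \<and> w y < w x)"
proof -
  let ?v = "w \<circ> transpose r e"
  have inj': "inj ?v" using inj by (simp add: inj_compose)
  have ne: "w a = w b \<longleftrightarrow> a = b" for a b using inj by (simp add: inj_eq)
  have ne': "w a = Suc (w r) \<longleftrightarrow> a = e" for a using ne[of a e] e by simp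
  have keep: "?v p < ?v q" if "w p < w q" "p \<noteq> r \<or> q \<noteq> e" for p q
    using that e ne[of p r] ne[of q r] ne'[of p] ne'[of q]
    by (auto simp: transpose_def less_Suc_eq)
  consider (three) x y z where "\<alpha> = [x, y, z]" "1 \<le> x" "x < y" "y < z" "w x < w z" "w z < w y"
    | (four) x y z t where "\<alpha> = [x, y, z, t]" "1 \<le> x" "x < y" "y < z" "z < t"
        "w x < w t" "w t < w z" "w z < w y"
    using \<alpha> unfolding occurrences_iff[OF inj] occurrences_iff[OF inj'] by blast
  then show ?thesis
  proof cases
    case three
    have "\<not> (?v x < ?v z \<and> ?v z < ?v y)"
      using \<alpha>(2) three unfolding occurrences_iff[OF inj'] by blast
    then have "x = r \<and> z = e \<or> z = r \<and> y = e" using keep three by blast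
    then have "x = r \<and> z = e" using three e by auto
    then show ?thesis using three by auto
  next
    case four
    have "\<not> (?v x < ?v t \<and> ?v t < ?v z \<and> ?v z < ?v y)"
      using \<alpha>(2) four unfolding occurrences_iff[OF inj'] by blast
    then have "x = r \<and> t = e \<or> t = r \<and> z = e \<or> z = r \<and> y = e" using keep four by blast
    then have "x = r \<and> t = e" using four e by auto
    then show ?thesis using four by auto
  qed
qed

text \<open>Take the smallest value above \<open>w r\<close> among the positions after \<open>r\<close> up to \<open>y\<close>.\<close>

lemma bruhat_cover_below:
  assumes "r < y" "w r < w y"
  shows "\<exists>z. z \<le> y \<and> w z \<le> w y \<and> bruhat_cover w r z"
proof -
  let ?A = "{z. r < z \<and> z \<le> y \<and> w r < w z}"
  have A: "finite ?A" "y \<in> ?A" using assms by auto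
  define z where "z = arg_min_on w ?A"
  have zA: "z \<in> ?A" unfolding z_def using A by (intro arg_min_if_finite) auto
  have z_min: "w z \<le> w m" if "m \<in> ?A" for m
    unfolding z_def using A that by (intro arg_min_least) auto
  have "bruhat_cover w r z"
    unfolding bruhat_cover_def
  proof (intro conjI allI impI)
    fix m assume "r < m" "m < z" "w r < w m"
    then have "m \<in> ?A" using zA by auto
    then show "\<not> w m < w z" using z_min by force
  qed (use zA in auto)
  then show ?thesis using zA z_min[OF A(2)] by blast
qed

text \<open>
  The charging scheme is written backwards, as a map \<open>\<psi>\<close> that recovers the charged occurrence of
  \<open>w\<close> from an element of the disjoint union on the right; then it only has to be seen that every
  occurrence is hit.
\<close>

lemma card_occurrences_le:
  assumes w: "w \<in> S_infinity" and r: "1 \<le> r" and e: "r < e" "e \<le> n" "w e = Suc (w r)"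
  shows "card (occurrences w) \<le>
    (\<Sum>j | j \<le> n \<and> bruhat_cover w r j. card (occurrences (w \<circ> transpose r j)))"
proof -
  let ?W = "\<lambda>j. w \<circ> transpose r j" and ?J = "{j. j \<le> n \<and> bruhat_cover w r j}"
  define p where "p = (LEAST j. r < j \<and> w r < w j)"
  have "r < e \<and> w r < w e" using e by simp
  then have "r < p \<and> w r < w p" unfolding p_def by (rule LeastI)
  then have p: "r < p" "w r < w p" by auto
  have p_le: "p \<le> m" if "r < m" "w r < w m" for m
    unfolding p_def using that by (intro Least_le) simp
  have pJ: "p \<in> ?J"
  proof -
    have "p \<le> n" using p_le[of e] e by simp
    moreover have "\<not> w r < w m" if "r < m" "m < p" for m using p_le[of m] that by auto
    ultimately show ?thesis using p by (auto simp: bruhat_cover_def)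
  qed
  have eJ: "e \<in> ?J" using e by (auto simp: bruhat_cover_def)
  \<comment> \<open>The tail \<open>s\<close> replaces an empty tuple by \<open>[j, e]\<close>. This handles at once the lost occurrences
    \<open>[r, p, e]\<close> and \<open>[r, p, y, e]\<close> with \<open>y \<in> ?J\<close>, which are charged to empty tuples.\<close>
  define \<psi> where "\<psi> = (\<lambda>(j, \<beta>). if j = e then \<beta> else
    let s = (if \<beta> = [] then [j, e] else tl \<beta>) in if j = p then r # s else r # p # s)"
  have W: "?W j \<in> S_infinity" if "r < j" for j
    using that r by (intro S_infinity_comp_transpose[OF w]) auto
  have injW: "inj (?W j)" if "r < j" for j using W[OF that] by (rule S_infinity_inj)
  have nil: "[] \<in> occurrences v" for v by (simp add: occurrences_def)
  have three_occ: "[j, x, e] \<in> occurrences (?W j)" if "r < j" "j < x" "x < e" "w e < w x" for j x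
    using that r e by (simp add: occurrences_iff[OF injW])
  have four_occ: "[j, x, y, e] \<in> occurrences (?W j)"
    if "r < j" "j < x" "x < y" "y < e" "w e < w y" "w y < w x" for j x y
    using that r e by (simp add: occurrences_iff[OF injW])
  have "occurrences w \<subseteq> \<psi> ` (SIGMA j:?J. occurrences (?W j))"
  proof
    fix \<alpha> assume \<alpha>: "\<alpha> \<in> occurrences w"
    have imageI: "\<psi> (j, \<beta>) \<in> \<psi> ` (SIGMA j:?J. occurrences (?W j))"
      if "j \<in> ?J" "\<beta> \<in> occurrences (?W j)" for j \<beta>
      using that by blast
    show "\<alpha> \<in> \<psi> ` (SIGMA j:?J. occurrences (?W j))"
    proof (cases "\<alpha> \<in> occurrences (?W e)")
      case True
      have "\<psi> (e, \<alpha>) = \<alpha>" by (simp add: \<psi>_def)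
      then show ?thesis using imageI[OF eJ True] by simp
    next
      case False
      from lost_occurrence[OF S_infinity_inj[OF w] e(1,3) \<alpha> False]
      consider (three) x where "\<alpha> = [r, x, e]" "r < x" "x < e" "w e < w x"
        | (four) x y where "\<alpha> = [r, x, y, e]" "r < x" "x < y" "y < e" "w e < w y" "w y < w x"
        by blast
      then show ?thesis
      proof cases
        case three
        have px: "p \<le> x" using p_le[of x] three e by simp
        show ?thesis
        proof (cases "x = p")
          case True
          have "\<psi> (p, []) = \<alpha>" using three True by (simp add: \<psi>_def)
          then show ?thesis using imageI[OF pJ nil] by simp
        next
          case False
          have "\<psi> (p, [p, x, e]) = \<alpha>" using three px by (simp add: \<psi>_def)
          then show ?thesis using imageI[OF pJ three_occ[of p x]] three px False p by simp
        qed
      next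
        case four
        have px: "p \<le> x" using p_le[of x] four e by simp
        show ?thesis
        proof (cases "x = p")
          case True
          \<comment> \<open>If \<open>z < y\<close>, then \<open>w r\<close>, \<open>w y\<close>, \<open>w e\<close> form a 132-pattern once \<open>w r\<close> is moved to \<open>z\<close>.\<close>
          obtain z where z: "z \<le> y" "w z \<le> w y" "bruhat_cover w r z"
            using bruhat_cover_below[of r y w] four e by auto
          have "z \<noteq> p" "z \<noteq> e" "r < z" using z four True by (auto simp: bruhat_cover_def)
          have zJ: "z \<in> ?J" using z four e by auto
          show ?thesis
          proof (cases "z = y")
            case True
            have "\<psi> (y, []) = \<alpha>" using four \<open>x = p\<close> by (simp add: \<psi>_def)
            then show ?thesis using imageI[OF zJ nil] True by simp
          next
            case False
            have "\<psi> (z, [z, y, e]) = \<alpha>"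
              using four \<open>x = p\<close> \<open>z \<noteq> p\<close> \<open>z \<noteq> e\<close> by (simp add: \<psi>_def)
            then show ?thesis
              using imageI[OF zJ three_occ[of z y]] four \<open>r < z\<close> z(1) False by simp
          qed
        next
          case False
          have "\<psi> (p, [p, x, y, e]) = \<alpha>" using four px by (simp add: \<psi>_def)
          then show ?thesis using imageI[OF pJ four_occ[of p x y]] four px False p by simp
        qed
      qed
    qed
  qed
  moreover have finJ: "finite ?J" by simp
  moreover have fin: "finite (occurrences (?W j))" if "j \<in> ?J" for j
    using that by (intro finite_occurrences W) (simp add: bruhat_cover_def)
  ultimately have "card (occurrences w) \<le> card (SIGMA j:?J. occurrences (?W j))"
    by (intro surj_card_le[where f = \<psi>] finite_SigmaI)
  also have "\<dots> = (\<Sum>j\<in>?J. card (occurrences (?W j)))"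
    using finJ fin by (intro card_SigmaI) auto
  finally show ?thesis .
qed

lemma occurrences_longest: "occurrences (longest_perm n) = {[]}"
proof -
  have inj: "inj (longest_perm n)" by (rule permutes_inj[OF longest_perm_permutes])
  have "n < y" if "1 \<le> x" "x < y" "longest_perm n x < longest_perm n y" for x y
    using that by (auto simp: longest_perm_def split: if_splits)
  then have "\<not> longest_perm n z < longest_perm n y"
    if "1 \<le> x" "x < y" "y < z" "longest_perm n x < longest_perm n y" for x y z
    using that by (fastforce simp: longest_perm_def)
  then show ?thesis
    unfolding set_eq_iff occurrences_iff[OF inj] singleton_iff by (meson less_trans)
qed

lemma perm_weight_comp_transpose_less:
  assumes "1 \<le> i" "i < j" "j \<le> n" "w i < w j"
  shows "perm_weight n (w \<circ> transpose i j) < perm_weight n w"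
proof -
  have sp: "(\<Sum>a=1..n. g a) = g i + g j + (\<Sum>a\<in>{1..n} - {i, j}. g a)" for g :: "nat \<Rightarrow> nat"
  proof -
    have "sum g {1..n} = sum g ({1..n} - {i, j}) + sum g {i, j}"
      using assms by (intro sum.subset_diff) auto
    then show ?thesis using assms by simp
  qed
  have "(\<Sum>a\<in>{1..n} - {i, j}. a * (w \<circ> transpose i j) a) = (\<Sum>a\<in>{1..n} - {i, j}. a * w a)"
    by (rule sum.cong) (auto simp: transpose_def)
  moreover have "i * w j + j * w i < i * w i + j * w j"
  proof -
    obtain d where d: "j = i + d" "0 < d" using assms by (metis less_imp_add_positive)
    obtain c where c: "w j = w i + c" "0 < c" using assms by (metis less_imp_add_positive)
    have "0 < d * c" using d c by simp
    then show ?thesis unfolding d(1) using c(1) d(1) by (simp add: algebra_simps)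
  qed
  ultimately show ?thesis using assms unfolding perm_weight_def sp[of "\<lambda>a. a * w a"]
      sp[of "\<lambda>a. a * (w \<circ> transpose i j) a"] by simp
qed

text \<open>
  A cover \<open>w \<circ> transpose r j\<close> with \<open>r < j \<le> n\<close> has smaller weight and still permutes \<open>{1..n}\<close>, so
  the induction ends at the longest permutation.
\<close>

lemma card_occurrences_le_principal_specialization:
  assumes "w permutes {1..n}" "1 \<le> n"
  shows "int (card (occurrences w)) \<le> principal_specialization w"
  using assms(1)
proof (induction "perm_weight n w" arbitrary: w rule: less_induct)
  case less
  note w = less.prems
  have S: "w \<in> S_infinity" using w assms(2) unfolding S_infinity_iff by blast
  have in_range: "w i \<in> {1..n} \<longleftrightarrow> i \<in> {1..n}" for i by (rule permutes_in_image[OF w])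
  have inj: "w i = w j \<longleftrightarrow> i = j" for i j using permutes_inj[OF w] by (simp add: inj_eq)
  show ?case
  proof (cases "w = longest_perm n")
    case True
    then show ?thesis
      using principal_specialization_longest[OF assms(2)] by (simp add: occurrences_longest)
  next
    case False
    \<comment> \<open>The cotransition formula applies at the first position at which \<open>w\<close> is not the longest
      permutation.\<close>
    let ?P = "\<lambda>i. 1 \<le> i \<and> i \<le> n \<and> w i \<noteq> n + 1 - i"
    define r where "r = (LEAST i. ?P i)"
    obtain i where "w i \<noteq> longest_perm n i" using False by (auto simp: fun_eq_iff)
    then have "?P i"
      using permutes_not_in[OF w, of i] by (auto simp: longest_perm_def split: if_splits)
    then have r: "?P r" unfolding r_def by (rule LeastI)
    have prefix: "w i = n + 1 - i" if "1 \<le> i" "i < r" for i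
      using not_less_Least[of i ?P] that r unfolding r_def by force
    \<comment> \<open>The values above \<open>n + 1 - r\<close> are taken by the prefix.\<close>
    have wr: "w r < n + 1 - r"
    proof (rule ccontr)
      assume "\<not> w r < n + 1 - r"
      moreover have "w r \<in> {1..n}" using in_range[of r] r by auto
      ultimately have "1 \<le> n + 1 - w r" "n + 1 - w r < r" using r by auto
      then have "w (n + 1 - w r) = w r" using prefix[of "n + 1 - w r"] \<open>w r \<in> {1..n}\<close> by auto
      then show False using inj \<open>n + 1 - w r < r\<close> by auto
    qed
    obtain e where e: "w e = Suc (w r)" using permutes_surj[OF w] by (metis surjD)
    have e_range: "e \<in> {1..n}" using in_range[of e] e wr r by auto
    have "r < e"
    proof (rule ccontr)
      assume "\<not> r < e"
      moreover have "e \<noteq> r" using e by auto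
      ultimately have "w e = n + 1 - e" "e < r" using prefix[of e] e_range by auto
      then show False using e wr r by auto
    qed
    let ?J = "{j. j \<le> n \<and> bruhat_cover w r j}"
    have IH: "int (card (occurrences (w \<circ> transpose r j))) \<le>
        principal_specialization (w \<circ> transpose r j)" if "j \<in> ?J" for j
    proof (rule less.hyps)
      have j: "r < j" "j \<le> n" "w r < w j" using that by (auto simp: bruhat_cover_def)
      then show "perm_weight n (w \<circ> transpose r j) < perm_weight n w"
        using r by (intro perm_weight_comp_transpose_less) auto
      show "w \<circ> transpose r j permutes {1..n}"
        using j r by (intro permutes_compose[OF _ w] permutes_swap_id) auto
    qed
    have "card (occurrences w) \<le> (\<Sum>j\<in>?J. card (occurrences (w \<circ> transpose r j)))"
      using card_occurrences_le[OF S _ \<open>r < e\<close> _ e, of n] r e_range by auto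
    then have "int (card (occurrences w)) \<le>
        (\<Sum>j\<in>?J. int (card (occurrences (w \<circ> transpose r j))))"
      by (simp flip: of_nat_sum)
    also have "\<dots> \<le> (\<Sum>j\<in>?J. principal_specialization (w \<circ> transpose r j))"
      by (rule sum_mono) (rule IH)
    also have "\<dots> = principal_specialization w"
      using principal_specialization_cotransition[OF w _ _ prefix wr] r by auto
    finally show ?thesis .
  qed
qed

theorem theorem2p1:
  fixes w :: "nat \<Rightarrow> nat"
  assumes "w \<in> S_infinity"
  shows "principal_specialization w
           \<ge> 1 + int (pattern_count [1,3,2] w) + int (pattern_count [1,4,3,2] w)"
proof -
  obtain n where "1 \<le> n" "w permutes {1..n}" using assms unfolding S_infinity_iff by blast
  then show ?thesis
    using card_occurrences_le_principal_specialization[of w n] card_occurrences[OF assms] by simp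
qed

end
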